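(* The systems of functions $\{\mathbf{c}_{n}\}_{n=0}^{\infty}$ and $\{\mathbf{s}_{n}\}_{n=1}^{\infty}$ are linearly independent, and they are complete in $C^{1}[-b,b]$ and in $C_{0}^{1}[-b,b]$, respectively (that is, the linear span of $\{\mathbf{c}_{n}\}_{n\ge 0}$ is dense in $C^{1}[-b,b]$ and the linear span of $\{\mathbf{s}_{n}\}_{n\ge1}$ is dense in $C_0^{1}[-b,b]$, with respect to the maximum norm).
   Context: Setting. Let $b>0$, let $q:[-b,b]\to\mathbb{C}$ be continuous, and let $f\in C^{2}[-b,b]$ be a complex-valued solution of $f''-qf=0$ with $f(x)\neq 0$ on $[-b,b]$ and $f(0)=1$. All function spaces consist of complex-valued functions; $C^1_0[-b,b]$ is the subspace of $C^1[-b,b]$ of functions vanishing at the origin. These spaces are equipped with the maximum norm. Recursive integrals: $X^{(0)}\equiv \widetilde X^{(0)}\equiv 1$ and, for $n\ge 1$, $$X^{(n)}(x)=n\int_{0}^{x}X^{(n-1)}(s)\bigl(f^{2}(s)\bigr)^{(-1)^{n}}ds,\qquad \widetilde X^{(n)}(x)=n\int_{0}^{x}\widetilde X^{(n-1)}(s)\bigl(f^{2}(s)\bigr)^{(-1)^{n-1}}ds .$$ Put $\varphi_k(x)=f(x)X^{(k)}(x)$ for $k$ odd and $\varphi_k(x)=f(x)\widetilde X^{(k)}(x)$ for $k$ even. Define $\mathbf{c}_0(x)=f(x)$ and, for $m\ge 1$, $$\mathbf{c}_{m}(x)=\sum_{\substack{0\le k\le m\\ k\text{ even}}}\binom{m}{k}x^{k}\varphi_{m-k}(x),\qquad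 \mathbf{s}_{m}(x)=\sum_{\substack{1\le k\le m\\ k\text{ odd}}}\binom{m}{k}x^{k}\varphi_{m-k}(x).$$ *)

theory Defs
  imports "HOL-Analysis.Analysis"
begin

(* Functions on an interval S are represented by total functions on the reals; only the values
   on S matter, so derivatives are taken within S (one-sided at the end points). *)

definition deriv_within :: "real set \<Rightarrow> (real \<Rightarrow> complex) \<Rightarrow> real \<Rightarrow> complex" where
  "deriv_within S u x = vector_derivative u (at x within S)"

fun C_space :: "nat \<Rightarrow> real set \<Rightarrow> (real \<Rightarrow> complex) set" where
  "C_space 0 S = {u. continuous_on S u}"
| "C_space (Suc k) S = {u. u differentiable_on S \<and> deriv_within S u \<in> C_space k S}"

definition C1_0_space :: "real set \<Rightarrow> (real \<Rightarrow> complex) set" where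
  "C1_0_space S = {u \<in> C_space 1 S. u 0 = 0}"

definition max_norm :: "real set \<Rightarrow> (real \<Rightarrow> complex) \<Rightarrow> real" where
  "max_norm S u = (SUP x\<in>S. norm (u x))"

(* The interval integral is oriented, so negative x is covered. *)

fun X_int :: "(real \<Rightarrow> complex) \<Rightarrow> nat \<Rightarrow> real \<Rightarrow> complex" where
  "X_int f 0 x = 1"
| "X_int f (Suc n) x =
     of_nat (Suc n) * (LBINT s=0..x. X_int f n s * ((f s)\<^sup>2) powi ((-1) ^ Suc n))"

fun X_tilde :: "(real \<Rightarrow> complex) \<Rightarrow> nat \<Rightarrow> real \<Rightarrow> complex" where
  "X_tilde f 0 x = 1"
| "X_tilde f (Suc n) x =
     of_nat (Suc n) * (LBINT s=0..x. X_tilde f n s * ((f s)\<^sup>2) powi ((-1) ^ n))"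

definition phi :: "(real \<Rightarrow> complex) \<Rightarrow> nat \<Rightarrow> real \<Rightarrow> complex" where
  "phi f k x = (if odd k then f x * X_int f k x else f x * X_tilde f k x)"

definition c_fun :: "(real \<Rightarrow> complex) \<Rightarrow> nat \<Rightarrow> real \<Rightarrow> complex" where
  "c_fun f m x =
     (if m = 0 then f x
      else (\<Sum>k | k \<le> m \<and> even k. of_nat (m choose k) * of_real x ^ k * phi f (m - k) x))"

definition s_fun :: "(real \<Rightarrow> complex) \<Rightarrow> nat \<Rightarrow> real \<Rightarrow> complex" where
  "s_fun f m x =
     (\<Sum>k | 1 \<le> k \<and> k \<le> m \<and> odd k. of_nat (m choose k) * of_real x ^ k * phi f (m - k) x)"

(* Linear independence of an indexed family of functions on S: a linear combination is the zero
   function when it vanishes at every point of S. *)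

definition lin_indep_on :: "real set \<Rightarrow> 'i set \<Rightarrow> ('i \<Rightarrow> real \<Rightarrow> complex) \<Rightarrow> bool" where
  "lin_indep_on S I g \<longleftrightarrow>
     (\<forall>J a. finite J \<and> J \<subseteq> I \<and> (\<forall>x\<in>S. (\<Sum>j\<in>J. a j * g j x) = 0) \<longrightarrow> (\<forall>j\<in>J. a j = 0))"

definition lin_span :: "'i set \<Rightarrow> ('i \<Rightarrow> real \<Rightarrow> complex) \<Rightarrow> (real \<Rightarrow> complex) set" where
  "lin_span I g = {\<lambda>x. \<Sum>j\<in>J. a j * g j x | J a. finite J \<and> J \<subseteq> I}"

definition complete_system ::
  "real set \<Rightarrow> (real \<Rightarrow> complex) set \<Rightarrow> 'i set \<Rightarrow> ('i \<Rightarrow> real \<Rightarrow> complex) \<Rightarrow> bool" where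
  "complete_system S E I g \<longleftrightarrow>
     (\<forall>i\<in>I. g i \<in> E) \<and>
     (\<forall>u\<in>E. \<forall>\<epsilon>>0. \<exists>v\<in>lin_span I g. max_norm S (\<lambda>x. u x - v x) < \<epsilon>)"

end

theory Submission imports Defs begin

text \<open>
  With \<open>Y\<^sub>k = \<phi>\<^sub>k / f\<close>, and \<open>Z\<^sub>k\<close> the recursive integral of order \<open>k\<close> from the other family,
  \<open>Y\<^sub>k' = k Z\<^sub>k\<^sub>-\<^sub>1 / f\<^sup>2\<close> and \<open>Z\<^sub>k' = k f\<^sup>2 Y\<^sub>k\<^sub>-\<^sub>1\<close>. Hence the binomial sums \<open>R\<close> and \<open>S\<close> formed from
  \<open>A\<^sub>k = f Y\<^sub>k + Z\<^sub>k / f\<close> and \<open>B\<^sub>k = f Y\<^sub>k - Z\<^sub>k / f\<close> solve the hyperbolic system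
  \<open>R\<^sub>x - R\<^sub>t = (f'/f) S\<close>, \<open>S\<^sub>x + S\<^sub>t = (f'/f) R\<close> with \<open>R(0,t) = 2 t\<^sup>m\<close>, \<open>S(0,t) = 0\<close>, and
  \<open>c\<^sub>m\<close>, \<open>s\<^sub>m\<close> are the even and odd parts in \<open>t\<close> of \<open>(R + S)/2\<close> on the characteristic \<open>t = x\<close>.
  A Gronwall estimate along characteristics shows that, for a polynomial \<open>p = \<Sum>a\<^sub>j y\<^sup>j\<close>, the combinations
  \<open>\<Sum>a\<^sub>j c\<^sub>j(x)\<close> and \<open>\<Sum>a\<^sub>j s\<^sub>j(x)\<close> differ from \<open>(p(2x) + p(0))/2\<close> and \<open>(p(2x) - p(0))/2\<close> by a Volterra-type
  term, which is small relative to the weighted norm \<open>sup |u(x)| exp (-2\<mu>|x|)\<close> when \<open>\<mu>\<close> is large. Linear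
  independence and density thus pass from the monomials to the two systems by a Neumann-type iteration.
\<close>

section \<open>Systems close to a given one in a weighted norm\<close>

lemma lin_spanI: "finite J \<Longrightarrow> J \<subseteq> I \<Longrightarrow> (\<lambda>x. \<Sum>j\<in>J. a j * g j x) \<in> lin_span I g"
  unfolding lin_span_def by blast

lemma lin_spanE:
  assumes "v \<in> lin_span I g"
  obtains J a where "finite J" "J \<subseteq> I" "v = (\<lambda>x. \<Sum>j\<in>J. a j * g j x)"
  using assms unfolding lin_span_def by blast

lemma lin_span_add:
  assumes "v \<in> lin_span I g" "w \<in> lin_span I g"
  shows "(\<lambda>x. v x + w x) \<in> lin_span I g"
proof -
  obtain J a where J: "finite J" "J \<subseteq> I" "v = (\<lambda>x. \<Sum>j\<in>J. a j * g j x)"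
    using assms(1) by (rule lin_spanE)
  obtain K c where K: "finite K" "K \<subseteq> I" "w = (\<lambda>x. \<Sum>j\<in>K. c j * g j x)"
    using assms(2) by (rule lin_spanE)
  define d where "d j = (if j \<in> J then a j else 0) + (if j \<in> K then c j else 0)" for j
  have "v x = (\<Sum>j\<in>J \<union> K. (if j \<in> J then a j else 0) * g j x)" for x
    unfolding J(3) using J(1) K(1) by (intro sum.mono_neutral_cong_left) auto
  moreover have "w x = (\<Sum>j\<in>J \<union> K. (if j \<in> K then c j else 0) * g j x)" for x
    unfolding K(3) using J(1) K(1) by (intro sum.mono_neutral_cong_left) auto
  ultimately have "(\<lambda>x. v x + w x) = (\<lambda>x. \<Sum>j\<in>J \<union> K. d j * g j x)"
    by (simp add: d_def sum.distrib distrib_right)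
  then show ?thesis
    using lin_spanI[of "J \<union> K" I d g] J K by simp
qed

lemma zero_in_lin_span: "(\<lambda>x. 0) \<in> lin_span I g"
  using lin_spanI[of "{}" I _ g] by simp

text \<open>Passing from a combination of \<open>D\<close> to the difference of the combinations of
  \<open>g\<close> and \<open>D\<close> with the same coefficients plays the part of a Volterra
  operator of weighted norm at most 1/2. The condition is put on coefficients, so that no operator
  has to be defined and no integral kernel constructed.\<close>

locale weighted_perturbation =
  fixes S :: "real set" and I :: "'i set" and w :: "real \<Rightarrow> real"
    and D g :: "'i \<Rightarrow> real \<Rightarrow> complex"
  assumes compact_S: "compact S"
    and weight_ge_1: "x \<in> S \<Longrightarrow> 1 \<le> w x"
    and perturbation: "\<lbrakk>finite J; J \<subseteq> I; 0 \<le> N; \<And>x. x \<in> S \<Longrightarrow> norm (\<Sum>j\<in>J. a j * D j x) \<le> N * w x;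
        x \<in> S\<rbrakk> \<Longrightarrow> norm ((\<Sum>j\<in>J. a j * g j x) - (\<Sum>j\<in>J. a j * D j x)) \<le> N / 2 * w x"
begin

lemma bounded_by_weight:
  assumes "continuous_on S u"
  obtains N where "0 < N" "\<And>x. x \<in> S \<Longrightarrow> norm (u x) \<le> N * w x"
proof -
  have "bounded (u ` S)"
    using assms compact_S compact_continuous_image compact_imp_bounded by blast
  then obtain N where N: "0 < N" "\<And>x. x \<in> S \<Longrightarrow> norm (u x) \<le> N"
    by (auto simp: bounded_pos)
  have "norm (u x) \<le> N * w x" if "x \<in> S" for x
  proof -
    have "N * 1 \<le> N * w x"
      using N(1) weight_ge_1[OF that] by (intro mult_left_mono) auto
    then show ?thesis using N(2)[OF that] by simp
  qed
  with N(1) show ?thesis using that by blast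
qed

text \<open>If the combination of \<open>g\<close> vanishes, that of \<open>D\<close> equals its own
  perturbation up to sign, so every weighted bound \<open>N\<close> for it can be halved; repetition
  forces it to be zero.\<close>

lemma lin_indep_perturbed:
  assumes cont: "\<And>j. j \<in> I \<Longrightarrow> continuous_on S (D j)"
    and indep: "lin_indep_on S I D"
  shows "lin_indep_on S I g"
  unfolding lin_indep_on_def
proof (intro allI impI, elim conjE)
  fix J a
  assume J: "finite J" "J \<subseteq> I" and zero: "\<forall>x\<in>S. (\<Sum>j\<in>J. a j * g j x) = 0"
  have "continuous_on S (\<lambda>x. \<Sum>j\<in>J. a j * D j x)"
    using J cont by (intro continuous_intros) auto
  then obtain N where N: "0 < N" "\<And>x. x \<in> S \<Longrightarrow> norm (\<Sum>j\<in>J. a j * D j x) \<le> N * w x"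
    using bounded_by_weight by blast
  have iter: "\<forall>x\<in>S. norm (\<Sum>j\<in>J. a j * D j x) \<le> N / 2 ^ n * w x" for n
  proof (induction n)
    case 0
    then show ?case using N by simp
  next
    case (Suc n)
    then show ?case
      using perturbation[OF J, of "N / 2 ^ n" a] zero N(1) by (simp add: norm_minus_commute field_simps)
  qed
  have "(\<Sum>j\<in>J. a j * D j x) = 0" if "x \<in> S" for x
  proof -
    have "(\<lambda>n. (N * w x) * (1 / 2) ^ n) \<longlonglongrightarrow> (N * w x) * 0"
      by (intro tendsto_intros LIMSEQ_realpow_zero) auto
    then have "(\<lambda>n. N / 2 ^ n * w x) \<longlonglongrightarrow> 0"
      by (simp add: power_one_over field_simps)
    then have "norm (\<Sum>j\<in>J. a j * D j x) \<le> 0"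
      by (rule LIMSEQ_le_const) (use iter that in auto)
    then show ?thesis by simp
  qed
  then show "\<forall>j\<in>J. a j = 0"
    using indep J unfolding lin_indep_on_def by blast
qed

text \<open>A Neumann iteration: the coefficients of an approximation from the span of
  \<open>D\<close>, reused with \<open>g\<close>, leave a residual whose weighted bound has shrunk
  by the factor 3/4. Since \<open>U\<close> is stable under subtracting elements of the span of
  \<open>g\<close>, the residual can be treated in the same way; \<open>W\<close> finally converts
  the weighted bound into a uniform one.\<close>

lemma dense_perturbed:
  assumes cont: "\<And>u. u \<in> U \<Longrightarrow> continuous_on S u"
    and closed: "\<And>u v. \<lbrakk>u \<in> U; v \<in> lin_span I g\<rbrakk> \<Longrightarrow> (\<lambda>x. u x - v x) \<in> U"
    and dense: "\<And>u e. \<lbrakk>u \<in> U; 0 < e\<rbrakk> \<Longrightarrow> \<exists>v\<in>lin_span I D. \<forall>x\<in>S. norm (u x - v x) \<le> e"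
    and weight: "\<And>x. x \<in> S \<Longrightarrow> w x \<le> W"
    and "u \<in> U" "0 < e"
  shows "\<exists>v\<in>lin_span I g. \<forall>x\<in>S. norm (u x - v x) \<le> e"
proof -
  have step: "\<exists>v\<in>lin_span I g. \<forall>x\<in>S. norm (u x - v x) \<le> (3/4) * N * w x"
    if u: "u \<in> U" and N: "0 < N" "\<forall>x\<in>S. norm (u x) \<le> N * w x" for u N
  proof -
    \<comment> \<open>With error N/8 the combination of \<open>D\<close> has weighted bound 9N/8, so
      exchanging \<open>D\<close> for \<open>g\<close> costs 9N/16. The total 11N/16 is below
      3N/4.\<close>
    obtain v where v: "v \<in> lin_span I D" "\<forall>x\<in>S. norm (u x - v x) \<le> N / 8"
      using dense[OF u, of "N / 8"] N(1) by auto
    obtain J a where J: "finite J" "J \<subseteq> I" and va: "v = (\<lambda>x. \<Sum>j\<in>J. a j * D j x)"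
      using v(1) by (rule lin_spanE)
    note Ja = v(2)[unfolded va]
    have close: "norm (u x - (\<Sum>j\<in>J. a j * D j x)) \<le> N / 8 * w x" if "x \<in> S" for x
    proof -
      have "N / 8 * 1 \<le> N / 8 * w x"
        using N(1) weight_ge_1[OF that] by (intro mult_left_mono) auto
      then show ?thesis using Ja that by force
    qed
    have D: "norm (\<Sum>j\<in>J. a j * D j x) \<le> (9 / 8 * N) * w x" if "x \<in> S" for x
    proof -
      have "norm (\<Sum>j\<in>J. a j * D j x) \<le> norm (u x) + norm (u x - (\<Sum>j\<in>J. a j * D j x))"
        by (metis norm_minus_commute norm_triangle_sub)
      also have "\<dots> \<le> N * w x + N / 8 * w x"
        using close[OF that] N(2) that by (intro add_mono) auto
      finally show ?thesis by (simp add: field_simps)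
    qed
    have "norm (u x - (\<Sum>j\<in>J. a j * g j x)) \<le> (3/4) * N * w x" if "x \<in> S" for x
    proof -
      have "norm ((\<Sum>j\<in>J. a j * g j x) - (\<Sum>j\<in>J. a j * D j x)) \<le> (9 / 8 * N) / 2 * w x"
        using J D that N(1) by (intro perturbation) auto
      then have "norm (u x - (\<Sum>j\<in>J. a j * g j x)) \<le> N / 8 * w x + (9 / 8 * N) / 2 * w x"
        using close[OF that] by (intro norm_diff_triangle_le) (auto simp: norm_minus_commute)
      also have "\<dots> = (11 / 16) * (N * w x)" by (simp add: field_simps)
      also have "\<dots> \<le> (3 / 4) * (N * w x)"
        using N(1) weight_ge_1[OF that] by (intro mult_right_mono) auto
      finally show ?thesis by (simp add: mult.assoc)
    qed
    then show ?thesis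
      by (intro bexI[OF _ lin_spanI[OF J, of a]]) auto
  qed
  obtain N where N: "0 < N" "\<And>x. x \<in> S \<Longrightarrow> norm (u x) \<le> N * w x"
    using bounded_by_weight cont \<open>u \<in> U\<close> by blast
  have iter: "\<exists>v\<in>lin_span I g. \<forall>x\<in>S. norm (u x - v x) \<le> (3/4) ^ n * N * w x" for n
  proof (induction n)
    case 0
    show ?case by (rule bexI[OF _ zero_in_lin_span]) (use N in auto)
  next
    case (Suc n)
    then obtain v where v: "v \<in> lin_span I g" "\<forall>x\<in>S. norm (u x - v x) \<le> (3/4) ^ n * N * w x"
      by blast
    obtain v' where v': "v' \<in> lin_span I g"
      "\<forall>x\<in>S. norm ((u x - v x) - v' x) \<le> (3/4) * ((3/4) ^ n * N) * w x"
      using step[OF closed[OF \<open>u \<in> U\<close> v(1)], of "(3/4) ^ n * N"] v(2) N(1) by auto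
    show ?case
      by (rule bexI[OF _ lin_span_add[OF v(1) v'(1)]]) (use v'(2) in \<open>simp add: algebra_simps\<close>)
  qed
  have "(\<lambda>n. (3/4) ^ n * (N * \<bar>W\<bar>)) \<longlonglongrightarrow> 0 * (N * \<bar>W\<bar>)"
    by (intro tendsto_intros LIMSEQ_realpow_zero) auto
  then have "\<forall>\<^sub>F n in sequentially. (3/4) ^ n * (N * \<bar>W\<bar>) < e"
    using \<open>0 < e\<close> by (intro order_tendstoD(2)[where y = 0]) auto
  then obtain n where n: "(3/4) ^ n * (N * \<bar>W\<bar>) < e"
    by (metis eventually_sequentially order_refl)
  obtain v where v: "v \<in> lin_span I g" "\<forall>x\<in>S. norm (u x - v x) \<le> (3/4) ^ n * N * w x"
    using iter by blast
  have "norm (u x - v x) \<le> e" if "x \<in> S" for x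
  proof -
    have "(3/4) ^ n * N * w x \<le> (3/4) ^ n * N * \<bar>W\<bar>"
      using N(1) weight[OF that] by (intro mult_left_mono) auto
    then show ?thesis
      using v(2)[rule_format, OF that] n unfolding mult.assoc by linarith
  qed
  then show ?thesis using v(1) by blast
qed

end

section \<open>Scaled monomials as the comparison system\<close>

text \<open>A vanishing combination is a polynomial with infinitely many roots, namely all points of
  the interval.\<close>

lemma monomials_lin_indep:
  fixes d :: "nat \<Rightarrow> complex"
  assumes "0 < b" and d: "\<And>j. d j \<noteq> 0"
  shows "lin_indep_on {-b..b} I (\<lambda>j x. d j * of_real x ^ j)"
  unfolding lin_indep_on_def
proof (intro allI impI, elim conjE)
  fix J a
  assume J: "finite J" and zero: "\<forall>x\<in>{-b..b}. (\<Sum>j\<in>J. a j * (d j * complex_of_real x ^ j)) = 0"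
  obtain n where n: "J \<subseteq> {..n}"
    using J by (meson finite_nat_iff_bounded_le)
  define c where "c j = (if j \<in> J then a j * d j else 0)" for j
  have eq: "(\<Sum>i\<le>n. c i * z ^ i) = (\<Sum>j\<in>J. a j * (d j * z ^ j))" for z
    using n unfolding c_def by (intro sum.mono_neutral_cong_right) (auto simp: mult.assoc)
  have "complex_of_real ` {-b..b} \<subseteq> {z. (\<Sum>i\<le>n. c i * z ^ i) = 0}"
    using zero eq by auto
  moreover have "infinite (complex_of_real ` {-b..b})"
    using \<open>0 < b\<close> by (subst finite_image_iff) (auto simp: infinite_Icc inj_on_def)
  ultimately have "infinite {z. (\<Sum>i\<le>n. c i * z ^ i) = 0}"
    using finite_subset by blast
  then have "\<forall>i\<le>n. c i = 0"
    unfolding polyfun_finite_roots by blast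
  then show "\<forall>j\<in>J. a j = 0"
    using n d unfolding c_def by (metis atMost_iff mult_eq_0_iff subsetD)
qed

text \<open>Weierstrass approximation is applied to the real and the imaginary part; the nonzero
  factors \<open>d j\<close> are absorbed into the coefficients.\<close>

lemma monomials_dense:
  fixes d :: "nat \<Rightarrow> complex" and u :: "real \<Rightarrow> complex"
  assumes d: "\<And>j. d j \<noteq> 0" and u: "continuous_on {-b..b} u" and "0 < e"
  shows "\<exists>v\<in>lin_span {0..} (\<lambda>j x. d j * of_real x ^ j). \<forall>x\<in>{-b..b}. norm (u x - v x) \<le> e"
proof -
  \<comment> \<open>Used with \<open>z\<close> equal to 1 for the real part and to \<i> for the
    imaginary part; modulus 1 preserves the error.\<close>
  have real: "\<exists>v\<in>lin_span {0..} (\<lambda>j x. d j * of_real x ^ j). \<forall>x\<in>{-b..b}. norm (z * of_real (h x) - v x) \<le> e / 2"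
    if h: "continuous_on {-b..b} h" and "norm z = 1" for h and z
  proof -
    obtain p where p: "real_polynomial_function p" "\<And>x. x \<in> {-b..b} \<Longrightarrow> \<bar>h x - p x\<bar> < e / 2"
      using Stone_Weierstrass_real_polynomial_function[OF compact_Icc h, of "e / 2"] \<open>0 < e\<close> by (metis half_gt_zero)
    obtain a n where an: "p = (\<lambda>x. \<Sum>i\<le>n. a i * x ^ i)"
      using p(1) real_polynomial_function_iff_sum by blast
    have *: "(\<lambda>x. z * of_real (p x)) = (\<lambda>x. \<Sum>j\<le>n. (z * of_real (a j) / d j) * (d j * of_real x ^ j))"
      by (simp add: an d sum_distrib_left mult.assoc)
    have "(\<lambda>x. z * of_real (p x)) \<in> lin_span {0..} (\<lambda>j x. d j * of_real x ^ j)"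
      unfolding * by (intro lin_spanI) auto
    moreover have "norm (z * of_real (h x) - z * of_real (p x)) \<le> e / 2" if "x \<in> {-b..b}" for x
    proof -
      have "z * of_real (h x) - z * of_real (p x) = z * of_real (h x - p x)"
        by (simp add: algebra_simps)
      then have "norm (z * of_real (h x) - z * of_real (p x)) = \<bar>h x - p x\<bar>"
        using \<open>norm z = 1\<close> by (simp add: norm_mult del: of_real_diff)
      then show ?thesis using p(2)[OF that] by simp
    qed
    ultimately show ?thesis
      by (intro bexI[where x = "\<lambda>x. z * of_real (p x)"] ballI)
  qed
  obtain v where v: "v \<in> lin_span {0..} (\<lambda>j x. d j * of_real x ^ j)"
      "\<forall>x\<in>{-b..b}. norm (1 * of_real (Re (u x)) - v x) \<le> e / 2"
    by (rule bexE[OF real[OF continuous_on_Re[OF u] norm_one]])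
  obtain v' where v': "v' \<in> lin_span {0..} (\<lambda>j x. d j * of_real x ^ j)"
      "\<forall>x\<in>{-b..b}. norm (\<i> * of_real (Im (u x)) - v' x) \<le> e / 2"
    by (rule bexE[OF real[OF continuous_on_Im[OF u] norm_ii]])
  have "norm (u x - (v x + v' x)) \<le> e" if "x \<in> {-b..b}" for x
  proof -
    have "u x - (v x + v' x) = (1 * of_real (Re (u x)) - v x) + (\<i> * of_real (Im (u x)) - v' x)"
      by (simp add: complex_eq_iff)
    also have "norm \<dots> \<le> e / 2 + e / 2"
      by (intro norm_triangle_mono v(2)[rule_format] v'(2)[rule_format] that)
    finally show ?thesis by simp
  qed
  then show ?thesis
    by (intro bexI[OF _ lin_span_add[OF v(1) v'(1)]]) auto
qed

text \<open>The constant term of an approximating polynomial is its value at 0, where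
  \<open>u\<close> vanishes. It is therefore no larger than the error and may be dropped at the
  price of doubling that error.\<close>

lemma monomials_dense_vanishing:
  fixes d :: "nat \<Rightarrow> complex" and u :: "real \<Rightarrow> complex"
  assumes "0 < b" and d: "\<And>j. d j \<noteq> 0" and u: "continuous_on {-b..b} u" "u 0 = 0" and "0 < e"
  shows "\<exists>v\<in>lin_span {1..} (\<lambda>j x. d j * of_real x ^ j). \<forall>x\<in>{-b..b}. norm (u x - v x) \<le> e"
proof -
  obtain p where p: "p \<in> lin_span {0..} (\<lambda>j x. d j * of_real x ^ j)"
      "\<forall>x\<in>{-b..b}. norm (u x - p x) \<le> e / 2"
    by (rule bexE[OF monomials_dense[of d, OF d u(1) half_gt_zero[OF \<open>0 < e\<close>]]])
  obtain J a where J: "finite J" and pa: "p = (\<lambda>x. \<Sum>j\<in>J. a j * (d j * of_real x ^ j))"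
    using p(1) by (rule lin_spanE)
  note Ja = p(2)[unfolded pa]
  define v where "v x = (\<Sum>j\<in>J - {0}. a j * (d j * complex_of_real x ^ j))" for x
  define c where "c = (if 0 \<in> J then a 0 * d 0 else 0)"
  have split: "(\<Sum>j\<in>J. a j * (d j * of_real x ^ j)) = c + v x" for x
    unfolding v_def c_def using J by (auto simp: sum.remove)
  have "v 0 = 0"
    unfolding v_def by (intro sum.neutral) auto
  then have "norm c \<le> e / 2"
    using Ja[rule_format, of 0] u(2) \<open>0 < b\<close> unfolding split by simp
  then have "norm (u x - v x) \<le> e" if "x \<in> {-b..b}" for x
    using Ja that norm_triangle_ineq[of "u x - (c + v x)" c] unfolding split by force
  moreover have "v \<in> lin_span {1..} (\<lambda>j x. d j * of_real x ^ j)"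
    unfolding v_def[abs_def] using J by (intro lin_spanI) (auto simp: Suc_le_eq)
  ultimately show ?thesis by blast
qed

section \<open>Estimates along characteristics\<close>

text \<open>The bound on the first coordinate keeps backward characteristics inside the interval on which \<open>f\<close> is defined.\<close>

definition backward_region :: "real \<Rightarrow> (real \<times> real) set" where
  "backward_region \<beta> = {(y, \<tau>). \<bar>y\<bar> \<le> \<beta> \<and> \<bar>y\<bar> + \<bar>\<tau>\<bar> \<le> 2 * \<beta>}"

lemma compact_backward_region: "compact (backward_region \<beta>)"
proof -
  have "backward_region \<beta> = ({-\<beta>..\<beta>} \<times> {-2*\<beta>..2*\<beta>}) \<inter> {z. \<bar>fst z\<bar> + \<bar>snd z\<bar> \<le> 2 * \<beta>}"
    unfolding backward_region_def by (auto simp: abs_le_iff)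
  moreover have "closed {z :: real \<times> real. \<bar>fst z\<bar> + \<bar>snd z\<bar> \<le> 2 * \<beta>}"
    by (intro closed_Collect_le continuous_intros)
  ultimately show ?thesis
    by (simp add: compact_Int_closed compact_Times)
qed

text \<open>A move along a characteristic towards the axis lowers \<bar>y\<bar> by at least as much
  as it can raise \<bar>\<tau>\<bar>, so neither \<bar>y\<bar> nor the sum of the two grows.\<close>

lemma backward_region_characteristic:
  assumes "(x, t) \<in> backward_region \<beta>" "\<sigma> \<in> {0..1}"
  shows "(x * \<sigma>, t + x * (1 - \<sigma>)) \<in> backward_region \<beta>"
    and "(x * \<sigma>, t - x * (1 - \<sigma>)) \<in> backward_region \<beta>"
    and "\<bar>x * \<sigma>\<bar> = \<bar>x\<bar> * \<sigma>"
proof -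
  show *: "\<bar>x * \<sigma>\<bar> = \<bar>x\<bar> * \<sigma>" using assms(2) by (simp add: abs_mult)
  have "\<bar>x\<bar> * \<sigma> \<le> \<bar>x\<bar> * 1" using assms(2) by (intro mult_left_mono) auto
  moreover have "\<bar>x * (1 - \<sigma>)\<bar> = \<bar>x\<bar> - \<bar>x\<bar> * \<sigma>"
    using assms(2) unfolding abs_mult by (simp add: right_diff_distrib)
  ultimately show "(x * \<sigma>, t + x * (1 - \<sigma>)) \<in> backward_region \<beta>"
    "(x * \<sigma>, t - x * (1 - \<sigma>)) \<in> backward_region \<beta>"
    using assms(1) abs_triangle_ineq[of t "x * (1 - \<sigma>)"] abs_triangle_ineq4[of t "x * (1 - \<sigma>)"]
    unfolding backward_region_def by (auto simp: *)
qed

text \<open>Serves to integrate along a characteristic, which \<sigma> traverses from the axis at 0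
  to the given point at 1.\<close>

lemma norm_increment_le:
  fixes h :: "real \<Rightarrow> complex" and \<phi> :: "real \<Rightarrow> real"
  assumes h: "\<And>\<sigma>. \<sigma> \<in> {0..1} \<Longrightarrow> (h has_vector_derivative h' \<sigma>) (at \<sigma> within {0..1})"
    and \<phi>: "\<And>\<sigma>. (\<phi> has_real_derivative \<phi>' \<sigma>) (at \<sigma>)"
    and le: "\<And>\<sigma>. \<sigma> \<in> {0..1} \<Longrightarrow> norm (h' \<sigma>) \<le> \<phi>' \<sigma>"
  shows "norm (h 1 - h 0) \<le> \<phi> 1 - \<phi> 0"
proof (rule differentiable_bound_general)
  show "(0::real) < 1" by simp
  show "continuous_on {0..1} h" by (rule continuous_on_vector_derivative) (rule h)
  show "continuous_on {0..1} \<phi>" using \<phi> by (meson DERIV_isCont continuous_at_imp_continuous_on)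
  show "(h has_vector_derivative h' \<sigma>) (at \<sigma>)" if "0 < \<sigma>" "\<sigma> < 1" for \<sigma>
    using h[of \<sigma>] that by (simp add: at_within_Icc_at)
  show "(\<phi> has_vector_derivative \<phi>' \<sigma>) (at \<sigma>)" for \<sigma>
    using \<phi> by (simp flip: has_real_derivative_iff_has_vector_derivative)
  show "norm (h' \<sigma>) \<le> \<phi>' \<sigma>" if "0 < \<sigma>" "\<sigma> < 1" for \<sigma>
    using le that by simp
qed

text \<open>\<open>Q\<close> stands for the error of the first wave against 2 p(x + t), and
  \<open>S\<close> for the second wave; both vanish on the axis. Measured with the weight exp
  (-2C\<bar>x\<bar>), the coupling returns only half of the maximum and can be absorbed, while
  integrating the exponential bound on the source \<open>p\<close> gains the factor 1/\<mu>.\<close>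

lemma characteristic_estimate:
  fixes Q S :: "real \<Rightarrow> real \<Rightarrow> complex" and r p :: "real \<Rightarrow> complex"
  assumes pos: "0 < C" "0 < \<mu>" "0 \<le> N" "0 \<le> \<beta>"
    and r: "\<And>y. \<bar>y\<bar> \<le> \<beta> \<Longrightarrow> norm (r y) \<le> C"
    and p: "\<And>y. \<bar>y\<bar> \<le> 2 * \<beta> \<Longrightarrow> norm (p y) \<le> N * exp (\<mu> * \<bar>y\<bar>)"
    and cont: "continuous_on (backward_region \<beta>) (\<lambda>z. Q (fst z) (snd z))"
      "continuous_on (backward_region \<beta>) (\<lambda>z. S (fst z) (snd z))"
    and init: "\<And>t. Q 0 t = 0" "\<And>t. S 0 t = 0"
    and Q': "\<And>x t \<sigma>. \<lbrakk>(x, t) \<in> backward_region \<beta>; \<sigma> \<in> {0..1}\<rbrakk> \<Longrightarrow>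
      ((\<lambda>\<sigma>. Q (x * \<sigma>) (t + x * (1 - \<sigma>))) has_vector_derivative
        of_real x * (r (x * \<sigma>) * S (x * \<sigma>) (t + x * (1 - \<sigma>)))) (at \<sigma> within {0..1})"
    and S': "\<And>x t \<sigma>. \<lbrakk>(x, t) \<in> backward_region \<beta>; \<sigma> \<in> {0..1}\<rbrakk> \<Longrightarrow>
      ((\<lambda>\<sigma>. S (x * \<sigma>) (t - x * (1 - \<sigma>))) has_vector_derivative
        of_real x * (r (x * \<sigma>) * (2 * p (x * \<sigma> + (t - x * (1 - \<sigma>))) + Q (x * \<sigma>) (t - x * (1 - \<sigma>)))))
        (at \<sigma> within {0..1})"
    and xt: "(x, t) \<in> backward_region \<beta>"
  shows "norm (Q x t) \<le> 4 * C * exp (2 * C * \<beta>) * N * exp (2 * \<mu> * \<beta>) / \<mu>"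
    and "norm (S x t) \<le> 4 * C * exp (2 * C * \<beta>) * N * exp (2 * \<mu> * \<beta>) / \<mu>"
proof -
  define W where "W z = exp (- (2 * C * \<bar>fst z\<bar>)) * max (norm (Q (fst z) (snd z))) (norm (S (fst z) (snd z)))" for z
  \<comment> \<open>\<open>E\<close> will bound the contribution of the source \<open>p\<close> to
    \<open>S\<close>: it is C N/\<mu> times the increment of an antiderivative that stays within exp
    (2 \<mu> \<beta>) in modulus, whence the factor 2.\<close>
  define E where "E = 2 * (C * N / \<mu>) * exp (2 * \<mu> * \<beta>)"
  have "continuous_on (backward_region \<beta>) W"
    unfolding W_def by (intro continuous_intros cont)
  then obtain z0 where z0: "z0 \<in> backward_region \<beta>" "\<And>z. z \<in> backward_region \<beta> \<Longrightarrow> W z \<le> W z0"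
    using continuous_attains_sup[OF compact_backward_region] xt by (metis empty_iff)
  define m where "m = W z0"
  have "0 \<le> m" unfolding m_def W_def by (simp add: le_max_iff_disj)
  have max_bound: "max (norm (Q y s)) (norm (S y s)) \<le> m * exp (2 * C * \<bar>y\<bar>)" if "(y, s) \<in> backward_region \<beta>" for y s
  proof -
    have "W (y, s) \<le> m"
      using z0(2)[OF that] unfolding m_def .
    then show ?thesis
      unfolding W_def by (simp add: exp_minus field_simps)
  qed
  have Q_bound: "norm (Q y s) \<le> m * exp (2 * C * \<bar>y\<bar>)"
    and S_bound: "norm (S y s) \<le> m * exp (2 * C * \<bar>y\<bar>)" if "(y, s) \<in> backward_region \<beta>" for y s
    using max_bound[OF that] by auto
  \<comment> \<open>The rate 2C in the weight is twice the bound on \<open>r\<close>; integration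
    therefore halves \<open>m\<close>.\<close>
  have Q_half: "norm (Q y s) \<le> m / 2 * exp (2 * C * \<bar>y\<bar>)" if ys: "(y, s) \<in> backward_region \<beta>" for y s
  proof -
    have "norm (Q (y * 1) (s + y * (1 - 1)) - Q (y * 0) (s + y * (1 - 0)))
        \<le> m / 2 * exp (2 * C * \<bar>y\<bar> * 1) - m / 2 * exp (2 * C * \<bar>y\<bar> * 0)"
    proof (rule norm_increment_le[OF Q'[OF ys]])
      show "((\<lambda>\<sigma>. m / 2 * exp (2 * C * \<bar>y\<bar> * \<sigma>)) has_real_derivative \<bar>y\<bar> * (C * (m * exp (2 * C * \<bar>y\<bar> * \<sigma>)))) (at \<sigma>)" for \<sigma>
        by (auto intro!: derivative_eq_intros)
      fix \<sigma> :: real assume \<sigma>: "\<sigma> \<in> {0..1}"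
      note reg = backward_region_characteristic[OF ys \<sigma>]
      have "norm (S (y * \<sigma>) (s + y * (1 - \<sigma>))) \<le> m * exp (2 * C * \<bar>y\<bar> * \<sigma>)"
        using S_bound[OF reg(1)] unfolding reg(3) by (simp add: mult.assoc)
      moreover have "norm (r (y * \<sigma>)) \<le> C"
        using r reg(1) by (simp add: backward_region_def)
      ultimately show "norm (of_real y * (r (y * \<sigma>) * S (y * \<sigma>) (s + y * (1 - \<sigma>)))) \<le> \<bar>y\<bar> * (C * (m * exp (2 * C * \<bar>y\<bar> * \<sigma>)))"
        unfolding norm_mult norm_of_real using pos(1) by (intro mult_left_mono mult_mono) auto
    qed
    then show ?thesis using init \<open>0 \<le> m\<close> by simp
  qed
  have S_half: "norm (S y s) \<le> E + m / 2 * exp (2 * C * \<bar>y\<bar>)" if ys: "(y, s) \<in> backward_region \<beta>" for y s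
  proof -
    define z where "z \<sigma> = y * \<sigma> + (s - y * (1 - \<sigma>))" for \<sigma>
    \<comment> \<open>Since exp (\<mu>\<bar>z\<bar>) is not differentiable at z = 0, it is majorised
      by exp (\<mu>z) + exp (-\<mu>z). As \<open>z\<close> has slope 2y, the derivative of
      \<open>e\<close> is 2\<mu>y times this majorant, and the factor \<open>sgn y\<close> used
      below turns y into \<bar>y\<bar>.\<close>
    define e where "e \<sigma> = exp (\<mu> * z \<sigma>) - exp (- (\<mu> * z \<sigma>))" for \<sigma>
    have z_le: "\<bar>z \<sigma>\<bar> \<le> 2 * \<beta>" if "\<sigma> \<in> {0..1}" for \<sigma>
      using backward_region_characteristic(2)[OF ys that] unfolding z_def backward_region_def by auto
    have e_le: "\<bar>e \<sigma>\<bar> \<le> exp (2 * \<mu> * \<beta>)" if "\<sigma> \<in> {0..1}" for \<sigma>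
    proof -
      have "\<bar>\<mu> * z \<sigma>\<bar> \<le> \<mu> * (2 * \<beta>)"
        using z_le[OF that] pos(2) by (simp add: abs_mult)
      then have "exp (\<mu> * z \<sigma>) \<le> exp (2 * \<mu> * \<beta>)" "exp (- (\<mu> * z \<sigma>)) \<le> exp (2 * \<mu> * \<beta>)"
        by (auto simp: abs_le_iff)
      moreover have "0 < exp (\<mu> * z \<sigma>)" "0 < exp (- (\<mu> * z \<sigma>))" by simp_all
      ultimately show ?thesis unfolding e_def by linarith
    qed
    have "norm (S (y * 1) (s - y * (1 - 1)) - S (y * 0) (s - y * (1 - 0)))
        \<le> (sgn y * (C * N / \<mu>) * e 1 + m / 2 * exp (2 * C * \<bar>y\<bar> * 1))
          - (sgn y * (C * N / \<mu>) * e 0 + m / 2 * exp (2 * C * \<bar>y\<bar> * 0))"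
    proof (rule norm_increment_le[OF S'[OF ys]])
      show "((\<lambda>\<sigma>. sgn y * (C * N / \<mu>) * e \<sigma> + m / 2 * exp (2 * C * \<bar>y\<bar> * \<sigma>)) has_real_derivative
          \<bar>y\<bar> * (C * (2 * (N * (exp (\<mu> * z \<sigma>) + exp (- (\<mu> * z \<sigma>)))) + m * exp (2 * C * \<bar>y\<bar> * \<sigma>)))) (at \<sigma>)" for \<sigma>
        unfolding e_def z_def using pos(2)
        by (auto intro!: derivative_eq_intros simp: field_simps abs_sgn)
      fix \<sigma> :: real assume \<sigma>: "\<sigma> \<in> {0..1}"
      note reg = backward_region_characteristic[OF ys \<sigma>]
      have "norm (Q (y * \<sigma>) (s - y * (1 - \<sigma>))) \<le> m * exp (2 * C * \<bar>y\<bar> * \<sigma>)"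
        using Q_bound[OF reg(2)] unfolding reg(3) by (simp add: mult.assoc)
      moreover have "norm (r (y * \<sigma>)) \<le> C"
        using r reg(1) by (simp add: backward_region_def)
      moreover have "norm (p (z \<sigma>)) \<le> N * (exp (\<mu> * z \<sigma>) + exp (- (\<mu> * z \<sigma>)))"
      proof -
        have "exp (\<mu> * \<bar>z \<sigma>\<bar>) \<le> exp (\<mu> * z \<sigma>) + exp (- (\<mu> * z \<sigma>))"
          by (cases "0 \<le> z \<sigma>") (auto simp: abs_if)
        then have "N * exp (\<mu> * \<bar>z \<sigma>\<bar>) \<le> N * (exp (\<mu> * z \<sigma>) + exp (- (\<mu> * z \<sigma>)))"
          using pos(3) by (rule mult_left_mono)
        then show ?thesis using p[OF z_le[OF \<sigma>]] by linarith
      qed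
      ultimately have "norm (r (y * \<sigma>)) * norm (2 * p (z \<sigma>) + Q (y * \<sigma>) (s - y * (1 - \<sigma>)))
        \<le> C * (2 * (N * (exp (\<mu> * z \<sigma>) + exp (- (\<mu> * z \<sigma>)))) + m * exp (2 * C * \<bar>y\<bar> * \<sigma>))"
        using pos(1) by (intro mult_mono norm_triangle_mono) (auto simp: norm_mult)
      then show "norm (of_real y * (r (y * \<sigma>) * (2 * p (y * \<sigma> + (s - y * (1 - \<sigma>))) + Q (y * \<sigma>) (s - y * (1 - \<sigma>)))))
        \<le> \<bar>y\<bar> * (C * (2 * (N * (exp (\<mu> * z \<sigma>) + exp (- (\<mu> * z \<sigma>)))) + m * exp (2 * C * \<bar>y\<bar> * \<sigma>)))"
        unfolding norm_mult norm_of_real z_def[symmetric] by (intro mult_left_mono) auto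
    qed
    then have "norm (S y s) \<le> (C * N / \<mu>) * (sgn y * e 1 - sgn y * e 0) + m / 2 * exp (2 * C * \<bar>y\<bar>)"
      using init \<open>0 \<le> m\<close> by (simp add: algebra_simps)
    also have "(C * N / \<mu>) * (sgn y * e 1 - sgn y * e 0) \<le> (C * N / \<mu>) * (2 * exp (2 * \<mu> * \<beta>))"
    proof (rule mult_left_mono)
      have "\<bar>e 1\<bar> \<le> exp (2 * \<mu> * \<beta>)" "\<bar>e 0\<bar> \<le> exp (2 * \<mu> * \<beta>)"
        using e_le by auto
      then show "sgn y * e 1 - sgn y * e 0 \<le> 2 * exp (2 * \<mu> * \<beta>)"
        by (auto simp: sgn_real_def abs_le_iff)
      show "0 \<le> C * N / \<mu>" using pos by simp
    qed
    finally show ?thesis unfolding E_def by simp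
  qed
  have "0 \<le> E" unfolding E_def using pos by simp
  \<comment> \<open>Both bounds are read off at the maximising point \<open>z0\<close>: the weight
    cancels the exponential next to m/2 and is at most 1 next to \<open>E\<close>.\<close>
  have "m \<le> E + m / 2"
  proof -
    obtain y s where ys: "z0 = (y, s)" by fastforce
    have "max (norm (Q y s)) (norm (S y s)) \<le> E + m / 2 * exp (2 * C * \<bar>y\<bar>)"
      using Q_half[of y s] S_half[of y s] z0(1) \<open>0 \<le> E\<close> unfolding ys by (auto intro: order_trans)
    then have "m \<le> exp (- (2 * C * \<bar>y\<bar>)) * (E + m / 2 * exp (2 * C * \<bar>y\<bar>))"
      unfolding m_def W_def ys fst_conv snd_conv by (intro mult_left_mono) auto
    also have "\<dots> = exp (- (2 * C * \<bar>y\<bar>)) * E + m / 2"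
      by (simp add: exp_minus field_simps)
    also have "\<dots> \<le> E + m / 2"
      using \<open>0 \<le> E\<close> pos(1) by (simp add: mult_left_le_one_le)
    finally show ?thesis .
  qed
  then have "m \<le> 2 * E" by simp
  have "m * exp (2 * C * \<bar>x\<bar>) \<le> (2 * E) * exp (2 * C * \<beta>)"
    using \<open>m \<le> 2 * E\<close> \<open>0 \<le> E\<close> pos xt by (intro mult_mono) (auto simp: backward_region_def)
  also have "\<dots> = 4 * C * exp (2 * C * \<beta>) * N * exp (2 * \<mu> * \<beta>) / \<mu>"
    unfolding E_def by simp
  finally have *: "m * exp (2 * C * \<bar>x\<bar>) \<le> 4 * C * exp (2 * C * \<beta>) * N * exp (2 * \<mu> * \<beta>) / \<mu>" .
  show "norm (Q x t) \<le> 4 * C * exp (2 * C * \<beta>) * N * exp (2 * \<mu> * \<beta>) / \<mu>"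
    "norm (S x t) \<le> 4 * C * exp (2 * C * \<beta>) * N * exp (2 * \<mu> * \<beta>) / \<mu>"
    using Q_bound[OF xt] S_bound[OF xt] * by linarith+
qed

section \<open>Continuously differentiable functions and binomial sums\<close>

text \<open>On a nondegenerate interval the one-sided derivatives are unique, so a derivative found
  by the usual rules agrees with the one selected by \<open>deriv_within\<close>.\<close>

lemma C_space_1_iff:
  assumes "a < b"
  shows "u \<in> C_space 1 {a..b} \<longleftrightarrow>
    (\<exists>u'. continuous_on {a..b} u' \<and> (\<forall>x\<in>{a..b}. (u has_vector_derivative u' x) (at x within {a..b})))"
    (is "?L \<longleftrightarrow> ?R")
proof
  assume ?L
  then have diff: "u differentiable_on {a..b}" and cont: "continuous_on {a..b} (deriv_within {a..b} u)"
    by simp_all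
  have "\<forall>x\<in>{a..b}. (u has_vector_derivative deriv_within {a..b} u x) (at x within {a..b})"
    using diff unfolding differentiable_on_def deriv_within_def by (simp add: vector_derivative_works)
  with cont show ?R by blast
next
  assume ?R
  then obtain u' where u': "continuous_on {a..b} u'"
    "\<And>x. x \<in> {a..b} \<Longrightarrow> (u has_vector_derivative u' x) (at x within {a..b})"
    by blast
  have "deriv_within {a..b} u x = u' x" if "x \<in> {a..b}" for x
    unfolding deriv_within_def by (rule vector_derivative_within_closed_interval[OF assms that u'(2)[OF that]])
  then have "continuous_on {a..b} (deriv_within {a..b} u)"
    by (intro continuous_on_eq[OF u'(1)]) simp
  moreover have "u differentiable_on {a..b}"
    using u'(2) unfolding differentiable_on_def by (blast intro: differentiableI_vector)
  ultimately show ?L by simp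
qed

lemma C_space_1I:
  assumes "a < b" "continuous_on {a..b} u'"
    "\<And>x. x \<in> {a..b} \<Longrightarrow> (u has_vector_derivative u' x) (at x within {a..b})"
  shows "u \<in> C_space 1 {a..b}"
  using assms C_space_1_iff by blast

lemma C_space_1E:
  assumes "u \<in> C_space 1 {a..b}" "a < b"
  obtains u' where "continuous_on {a..b} u'"
    "\<And>x. x \<in> {a..b} \<Longrightarrow> (u has_vector_derivative u' x) (at x within {a..b})"
  using assms C_space_1_iff by blast

lemma C_space_1_continuous:
  assumes "u \<in> C_space 1 S"
  shows "continuous_on S u"
  using assms by (simp add: differentiable_imp_continuous_on)

lemma C_space_1_mult:
  assumes "a < b" "u \<in> C_space 1 {a..b}" "v \<in> C_space 1 {a..b}"
  shows "(\<lambda>x. u x * v x) \<in> C_space 1 {a..b}"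
proof -
  obtain u' where u': "continuous_on {a..b} u'"
    "\<And>x. x \<in> {a..b} \<Longrightarrow> (u has_vector_derivative u' x) (at x within {a..b})"
    using C_space_1E assms by metis
  obtain v' where v': "continuous_on {a..b} v'"
    "\<And>x. x \<in> {a..b} \<Longrightarrow> (v has_vector_derivative v' x) (at x within {a..b})"
    using C_space_1E assms by metis
  show ?thesis
  proof (rule C_space_1I[OF assms(1)])
    show "continuous_on {a..b} (\<lambda>x. u x * v' x + u' x * v x)"
      using assms(2,3)[THEN C_space_1_continuous] u'(1) v'(1) by (intro continuous_intros)
  qed (intro has_vector_derivative_mult u' v')
qed

lemma C_space_1_diff:
  assumes "a < b" "u \<in> C_space 1 {a..b}" "v \<in> C_space 1 {a..b}"
  shows "(\<lambda>x. u x - v x) \<in> C_space 1 {a..b}"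
proof -
  obtain u' where u': "continuous_on {a..b} u'"
    "\<And>x. x \<in> {a..b} \<Longrightarrow> (u has_vector_derivative u' x) (at x within {a..b})"
    using C_space_1E assms by metis
  obtain v' where v': "continuous_on {a..b} v'"
    "\<And>x. x \<in> {a..b} \<Longrightarrow> (v has_vector_derivative v' x) (at x within {a..b})"
    using C_space_1E assms by metis
  show ?thesis
  proof (rule C_space_1I[OF assms(1)])
    show "continuous_on {a..b} (\<lambda>x. u' x - v' x)"
      using u'(1) v'(1) by (intro continuous_intros)
  qed (intro has_vector_derivative_diff u' v')
qed

lemma C_space_1_const: "a < b \<Longrightarrow> (\<lambda>x. c) \<in> C_space 1 {a..b}"
  by (rule C_space_1I[where u' = "\<lambda>x. 0"]) auto

lemma C_space_1_add:
  assumes "a < b" "u \<in> C_space 1 {a..b}" "v \<in> C_space 1 {a..b}"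
  shows "(\<lambda>x. u x + v x) \<in> C_space 1 {a..b}"
  using C_space_1_diff[OF assms(1,2) C_space_1_diff[OF assms(1) C_space_1_const[OF assms(1), of 0] assms(3)]]
  by simp

lemma C_space_1_sum:
  assumes "a < b" "\<And>i. i \<in> I \<Longrightarrow> u i \<in> C_space 1 {a..b}"
  shows "(\<lambda>x. \<Sum>i\<in>I. u i x) \<in> C_space 1 {a..b}"
  using assms(2)
proof (induction I rule: infinite_finite_induct)
  case (insert i I)
  have "(\<lambda>x. u i x + (\<Sum>i\<in>I. u i x)) \<in> C_space 1 {a..b}"
    using insert by (intro C_space_1_add assms(1)) auto
  then show ?case using insert by (simp del: C_space.simps)
qed (simp_all only: sum.infinite sum.empty not_False_eq_True C_space_1_const[OF assms(1)])

lemma C_space_1_power_of_real: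
  assumes "a < b"
  shows "(\<lambda>x. of_real x ^ n) \<in> C_space 1 {a..b}"
proof (induction n)
  case 0
  then show ?case using C_space_1_const[OF assms, of 1] by (simp del: C_space.simps)
next
  case (Suc n)
  have "complex_of_real \<in> C_space 1 {a..b}"
    by (rule C_space_1I[OF assms, where u' = "\<lambda>x. 1"]) (auto intro!: derivative_eq_intros)
  then show ?case
    using C_space_1_mult[OF assms _ Suc, of complex_of_real] by (simp del: C_space.simps)
qed

section \<open>Binomial sums under transport\<close>

lemma has_vector_derivative_power:
  fixes T :: "real \<Rightarrow> complex"
  assumes "(T has_vector_derivative T') (at \<sigma> within A)"
  shows "((\<lambda>\<sigma>. T \<sigma> ^ k) has_vector_derivative of_nat k * T \<sigma> ^ (k - 1) * T') (at \<sigma> within A)"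
proof -
  have "((\<lambda>z. z ^ k) has_field_derivative of_nat k * T \<sigma> ^ (k - 1)) (at (T \<sigma>) within T ` A)"
    by (auto intro!: derivative_eq_intros)
  from field_vector_diff_chain_within[OF assms this] show ?thesis
    by (simp add: o_def mult.commute)
qed

text \<open>Rests on (m - k) C(m,k) = (k + 1) C(m,k + 1) and a shift of the index. The term k = m on
  the left and the term k = 0 on the right carry a zero factor, so the truncated subtractions there
  are harmless.\<close>

lemma sum_binomial_shift:
  fixes a :: "nat \<Rightarrow> complex"
  shows "(\<Sum>k\<le>m. of_nat (m choose k) * (of_nat (m - k) * a (m - k - 1) * z ^ k)) =
    (\<Sum>k\<le>m. of_nat (m choose k) * (a (m - k) * (of_nat k * z ^ (k - 1))))"
proof (cases m)
  case (Suc n)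
  have "(\<Sum>k\<le>m. of_nat (m choose k) * (of_nat (m - k) * a (m - k - 1) * z ^ k)) =
    (\<Sum>k\<le>n. of_nat ((Suc n - k) * (Suc n choose k)) * (a (n - k) * z ^ k))"
    unfolding Suc sum.atMost_Suc by (auto intro!: sum.cong simp: of_nat_diff)
  also have "\<dots> = (\<Sum>k\<le>n. of_nat (Suc k * (Suc n choose Suc k)) * (a (n - k) * z ^ k))"
  proof -
    have "(Suc n - k) * (Suc n choose k) = Suc k * (Suc n choose Suc k)" for k
      using binomial_absorb_comp[of "Suc n" k] Suc_times_binomial_eq[of n k] by (simp only: diff_Suc_1 mult.commute)
    then show ?thesis by (simp only:)
  qed
  also have "\<dots> = (\<Sum>k\<le>m. of_nat (m choose k) * (a (m - k) * (of_nat k * z ^ (k - 1))))"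
    unfolding Suc sum.atMost_Suc_shift by (simp add: mult_ac del: binomial_Suc_Suc of_nat_Suc mult_Suc)
  finally show ?thesis .
qed simp

text \<open>Differentiating a power of \<open>T\<close> lowers the exponent, and the recursion for
  \<open>a\<close> lowers the index. By \<open>sum_binomial_shift\<close> the two effects cancel at
  the given speed of \<open>T\<close>, and only the coupling terms \<open>c\<close> survive.\<close>

lemma binomial_transport:
  fixes a :: "nat \<Rightarrow> real \<Rightarrow> complex" and T :: "real \<Rightarrow> complex"
  assumes a: "\<And>k. (a k has_vector_derivative x * (c k + s * (of_nat k * a (k - 1) \<sigma>))) (at \<sigma> within A)"
    and T: "(T has_vector_derivative - (x * s)) (at \<sigma> within A)"
  shows "((\<lambda>\<sigma>. \<Sum>k\<le>m. of_nat (m choose k) * (a (m - k) \<sigma> * T \<sigma> ^ k)) has_vector_derivative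
    x * (\<Sum>k\<le>m. of_nat (m choose k) * (c (m - k) * T \<sigma> ^ k))) (at \<sigma> within A)"
proof -
  have "((\<lambda>\<sigma>. \<Sum>k\<le>m. of_nat (m choose k) * (a (m - k) \<sigma> * T \<sigma> ^ k)) has_vector_derivative
    (\<Sum>k\<le>m. of_nat (m choose k) * (a (m - k) \<sigma> * (of_nat k * T \<sigma> ^ (k - 1) * - (x * s))
      + x * (c (m - k) + s * (of_nat (m - k) * a (m - k - 1) \<sigma>)) * T \<sigma> ^ k))) (at \<sigma> within A)"
    by (intro has_vector_derivative_sum has_vector_derivative_mult_right has_vector_derivative_mult
        has_vector_derivative_power a T)
  also have "(\<Sum>k\<le>m. of_nat (m choose k) * (a (m - k) \<sigma> * (of_nat k * T \<sigma> ^ (k - 1) * - (x * s))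
      + x * (c (m - k) + s * (of_nat (m - k) * a (m - k - 1) \<sigma>)) * T \<sigma> ^ k))
    = x * (\<Sum>k\<le>m. of_nat (m choose k) * (c (m - k) * T \<sigma> ^ k))
      + x * s * ((\<Sum>k\<le>m. of_nat (m choose k) * (of_nat (m - k) * a (m - k - 1) \<sigma> * T \<sigma> ^ k))
        - (\<Sum>k\<le>m. of_nat (m choose k) * (a (m - k) \<sigma> * (of_nat k * T \<sigma> ^ (k - 1)))))"
    unfolding sum_distrib_left sum_subtractf[symmetric] sum.distrib[symmetric]
    by (intro sum.cong refl) (simp add: algebra_simps)
  also have "\<dots> = x * (\<Sum>k\<le>m. of_nat (m choose k) * (c (m - k) * T \<sigma> ^ k))"
    unfolding sum_binomial_shift[where a = "\<lambda>k. a k \<sigma>"] by simp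
  finally show ?thesis .
qed

section \<open>Recursive integrals and the wave form of the two systems\<close>

definition Y_int :: "(real \<Rightarrow> complex) \<Rightarrow> nat \<Rightarrow> real \<Rightarrow> complex" where
  "Y_int f k = (if odd k then X_int f k else X_tilde f k)"

definition Z_int :: "(real \<Rightarrow> complex) \<Rightarrow> nat \<Rightarrow> real \<Rightarrow> complex" where
  "Z_int f k = (if odd k then X_tilde f k else X_int f k)"

lemma phi_eq: "phi f k x = f x * Y_int f k x"
  by (simp add: phi_def Y_int_def)

text \<open>Choosing the family by the parity of the order removes the alternation: f^2 enters here
  always with exponent -1, and in \<open>Z_int_Suc\<close> always with exponent 1.\<close>

lemma Y_int_Suc: "Y_int f (Suc n) x = of_nat (Suc n) * (LBINT s=0..x. Z_int f n s / (f s)\<^sup>2)"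
  by (simp add: Y_int_def Z_int_def power_int_minus field_simps)

lemma Z_int_Suc: "Z_int f (Suc n) x = of_nat (Suc n) * (LBINT s=0..x. Y_int f n s * (f s)\<^sup>2)"
  by (simp add: Y_int_def Z_int_def)

lemma YZ_int_0: "Y_int f 0 x = 1" "Z_int f 0 x = 1"
  by (simp_all add: Y_int_def Z_int_def)

definition A_coeff :: "(real \<Rightarrow> complex) \<Rightarrow> nat \<Rightarrow> real \<Rightarrow> complex" where
  "A_coeff f k x = f x * Y_int f k x + Z_int f k x / f x"

definition B_coeff :: "(real \<Rightarrow> complex) \<Rightarrow> nat \<Rightarrow> real \<Rightarrow> complex" where
  "B_coeff f k x = f x * Y_int f k x - Z_int f k x / f x"

text \<open>With \<open>A_coeff f\<close> and \<open>B_coeff f\<close> in place of \<open>a\<close>,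
  these are the components R and S of the hyperbolic system.\<close>

definition binomial_wave :: "(nat \<Rightarrow> real \<Rightarrow> complex) \<Rightarrow> nat \<Rightarrow> real \<Rightarrow> real \<Rightarrow> complex" where
  "binomial_wave a m x t = (\<Sum>k\<le>m. of_nat (m choose k) * (a (m - k) x * of_real t ^ k))"

lemma AB_wave_add:
  "binomial_wave (A_coeff f) m x t + binomial_wave (B_coeff f) m x t =
    2 * (\<Sum>k\<le>m. of_nat (m choose k) * of_real t ^ k * phi f (m - k) x)"
  unfolding binomial_wave_def A_coeff_def B_coeff_def phi_eq sum_distrib_left sum.distrib[symmetric]
  by (intro sum.cong) (auto simp: algebra_simps)

text \<open>Averaging over t = x and t = -x keeps the even powers of t. One factor 1/2 belongs to
  this average, the other compensates the 2 in \<open>AB_wave_add\<close>.\<close>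

lemma c_fun_eq:
  "c_fun f m x = ((binomial_wave (A_coeff f) m x x + binomial_wave (B_coeff f) m x x)
    + (binomial_wave (A_coeff f) m x (-x) + binomial_wave (B_coeff f) m x (-x))) / 4"
proof -
  have "c_fun f m x = (\<Sum>k | k \<le> m \<and> even k. of_nat (m choose k) * of_real x ^ k * phi f (m - k) x)"
  proof -
    \<comment> \<open>The separate clause of \<open>c_fun\<close> for index 0 agrees with the
      general sum, because \<open>phi f 0\<close> equals \<open>f\<close>.\<close>
    have "{k. k \<le> 0 \<and> even k} = {0::nat}" by auto
    then show ?thesis by (simp add: c_fun_def phi_eq YZ_int_0)
  qed
  also have "\<dots> = (\<Sum>k\<le>m. if even k then of_nat (m choose k) * of_real x ^ k * phi f (m - k) x else 0)"
    by (intro sum.mono_neutral_cong_left) auto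
  also have "\<dots> = (\<Sum>k\<le>m. (of_nat (m choose k) * of_real x ^ k * phi f (m - k) x
      + of_nat (m choose k) * of_real (-x) ^ k * phi f (m - k) x) / 2)"
    by (intro sum.cong) auto
  finally have "c_fun f m x = ((\<Sum>k\<le>m. of_nat (m choose k) * of_real x ^ k * phi f (m - k) x)
      + (\<Sum>k\<le>m. of_nat (m choose k) * of_real (-x) ^ k * phi f (m - k) x)) / 2"
    by (simp add: sum.distrib flip: sum_divide_distrib)
  then show ?thesis
    unfolding AB_wave_add by (simp add: add_divide_distrib)
qed

lemma s_fun_eq:
  "s_fun f m x = ((binomial_wave (A_coeff f) m x x + binomial_wave (B_coeff f) m x x)
    - (binomial_wave (A_coeff f) m x (-x) + binomial_wave (B_coeff f) m x (-x))) / 4"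
proof -
  have "s_fun f m x = (\<Sum>k\<le>m. if odd k then of_nat (m choose k) * of_real x ^ k * phi f (m - k) x else 0)"
    unfolding s_fun_def by (intro sum.mono_neutral_cong_left) (auto elim: oddE)
  also have "\<dots> = (\<Sum>k\<le>m. (of_nat (m choose k) * of_real x ^ k * phi f (m - k) x
      - of_nat (m choose k) * of_real (-x) ^ k * phi f (m - k) x) / 2)"
    by (intro sum.cong) auto
  finally have "s_fun f m x = ((\<Sum>k\<le>m. of_nat (m choose k) * of_real x ^ k * phi f (m - k) x)
      - (\<Sum>k\<le>m. of_nat (m choose k) * of_real (-x) ^ k * phi f (m - k) x)) / 2"
    by (simp add: sum_subtractf flip: sum_divide_distrib)
  then show ?thesis
    unfolding AB_wave_add by (simp add: diff_divide_distrib)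
qed

section \<open>The traces of the wave polynomials\<close>

locale nonvanishing_C1 =
  fixes b :: real and f f' :: "real \<Rightarrow> complex"
  assumes b_pos: "0 < b"
    and f_deriv: "x \<in> {-b..b} \<Longrightarrow> (f has_vector_derivative f' x) (at x within {-b..b})"
    and f'_cont: "continuous_on {-b..b} f'"
    and f_nonzero: "x \<in> {-b..b} \<Longrightarrow> f x \<noteq> 0"
    and f_0: "f 0 = 1"
begin

definition log_deriv :: "real \<Rightarrow> complex" where "log_deriv x = f' x / f x"

lemma f_cont: "continuous_on {-b..b} f"
  using f_deriv by (rule continuous_on_vector_derivative)

lemma log_deriv_cont: "continuous_on {-b..b} log_deriv"
  unfolding log_deriv_def[abs_def] using f_cont f'_cont f_nonzero by (intro continuous_intros) auto

lemma int_deriv: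
  fixes g :: "real \<Rightarrow> complex"
  assumes "continuous_on {-b..b} g" "x \<in> {-b..b}"
  shows "((\<lambda>x. LBINT s=0..x. g s) has_vector_derivative g x) (at x within {-b..b})"
  using interval_integral_FTC2[of "-b" 0 b g x] assms b_pos by (simp add: zero_ereal_def)

lemma int_cont: "continuous_on {-b..b} g \<Longrightarrow> continuous_on {-b..b} (\<lambda>x. LBINT s=0..x. g s :: complex)"
  by (rule continuous_on_vector_derivative) (rule int_deriv)

lemma YZ_int_cont: "continuous_on {-b..b} (Y_int f n) \<and> continuous_on {-b..b} (Z_int f n)"
proof (induction n)
  case 0
  have "Y_int f 0 = (\<lambda>x. 1)" "Z_int f 0 = (\<lambda>x. 1)" using YZ_int_0 by blast+
  then show ?case by simp
next
  case (Suc n)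
  have "continuous_on {-b..b} (\<lambda>s. Z_int f n s / (f s)\<^sup>2)" "continuous_on {-b..b} (\<lambda>s. Y_int f n s * (f s)\<^sup>2)"
    using Suc f_cont f_nonzero by (auto intro!: continuous_intros)
  then show ?case
    unfolding Y_int_Suc[abs_def] Z_int_Suc[abs_def] by (intro conjI continuous_on_mult_left int_cont)
qed

lemma Y_int_deriv:
  assumes "x \<in> {-b..b}"
  shows "(Y_int f k has_vector_derivative of_nat k * (Z_int f (k - 1) x / (f x)\<^sup>2)) (at x within {-b..b})"
proof (cases k)
  case 0
  have "Y_int f 0 = (\<lambda>x. 1)" using YZ_int_0 by blast
  then show ?thesis using 0 by simp
next
  case (Suc n)
  have "continuous_on {-b..b} (\<lambda>s. Z_int f n s / (f s)\<^sup>2)"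
    using YZ_int_cont f_cont f_nonzero by (auto intro!: continuous_intros)
  then show ?thesis
    unfolding Suc Y_int_Suc[abs_def] diff_Suc_1 by (intro has_vector_derivative_mult_right int_deriv assms)
qed

lemma Z_int_deriv:
  assumes "x \<in> {-b..b}"
  shows "(Z_int f k has_vector_derivative of_nat k * (Y_int f (k - 1) x * (f x)\<^sup>2)) (at x within {-b..b})"
proof (cases k)
  case 0
  have "Z_int f 0 = (\<lambda>x. 1)" using YZ_int_0 by blast
  then show ?thesis using 0 by simp
next
  case (Suc n)
  have "continuous_on {-b..b} (\<lambda>s. Y_int f n s * (f s)\<^sup>2)"
    using YZ_int_cont f_cont by (auto intro!: continuous_intros)
  then show ?thesis
    unfolding Suc Z_int_Suc[abs_def] diff_Suc_1 by (intro has_vector_derivative_mult_right int_deriv assms)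
qed

lemma Z_quotient_deriv:
  assumes x: "x \<in> {-b..b}"
  shows "((\<lambda>x. Z_int f k x / f x) has_vector_derivative
    of_nat k * (f x * Y_int f (k - 1) x) - log_deriv x * (Z_int f k x / f x)) (at x within {-b..b})"
proof -
  have "(inverse has_field_derivative - (inverse (f x) * inverse (f x))) (at (f x) within f ` {-b..b})"
    using f_nonzero[OF x] by (auto intro!: derivative_eq_intros)
  from field_vector_diff_chain_within[OF f_deriv[OF x] this]
  have "((\<lambda>x. inverse (f x)) has_vector_derivative f' x * - (inverse (f x) * inverse (f x))) (at x within {-b..b})"
    by (simp add: o_def)
  from has_vector_derivative_mult[OF Z_int_deriv[OF x] this] show ?thesis
    unfolding divide_inverse log_deriv_def
    by (rule has_vector_derivative_eq_rhs) (use f_nonzero[OF x] in \<open>simp add: field_simps power2_eq_square\<close>)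
qed

lemma phi_quotient_deriv:
  assumes x: "x \<in> {-b..b}"
  shows "((\<lambda>x. f x * Y_int f k x) has_vector_derivative
    log_deriv x * (f x * Y_int f k x) + of_nat k * (Z_int f (k - 1) x / f x)) (at x within {-b..b})"
  using has_vector_derivative_mult[OF f_deriv[OF x] Y_int_deriv[OF x, of k]]
  by (rule has_vector_derivative_eq_rhs) (use f_nonzero[OF x] in \<open>simp add: log_deriv_def field_simps power2_eq_square\<close>)

text \<open>The logarithmic derivative enters the derivatives of f Y and Z/f with opposite signs, so
  it couples their sum to their difference. The index-lowering terms swap f Y and Z/f, which
  reproduces the sum and, in \<open>B_coeff_deriv\<close>, the difference with reversed
  sign.\<close>

lemma A_coeff_deriv:
  assumes "x \<in> {-b..b}"
  shows "(A_coeff f k has_vector_derivative log_deriv x * B_coeff f k x + of_nat k * A_coeff f (k - 1) x) (at x within {-b..b})"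
  unfolding A_coeff_def[abs_def] B_coeff_def[abs_def]
  using has_vector_derivative_add[OF phi_quotient_deriv[OF assms] Z_quotient_deriv[OF assms]]
  by (rule has_vector_derivative_eq_rhs) (simp add: algebra_simps)

lemma B_coeff_deriv:
  assumes "x \<in> {-b..b}"
  shows "(B_coeff f k has_vector_derivative log_deriv x * A_coeff f k x - of_nat k * B_coeff f (k - 1) x) (at x within {-b..b})"
  unfolding A_coeff_def[abs_def] B_coeff_def[abs_def]
  using has_vector_derivative_diff[OF phi_quotient_deriv[OF assms] Z_quotient_deriv[OF assms]]
  by (rule has_vector_derivative_eq_rhs) (simp add: algebra_simps)

lemma phi_C1: "phi f k \<in> C_space 1 {-b..b}"
proof (rule C_space_1I)
  show "continuous_on {-b..b} (\<lambda>x. log_deriv x * (f x * Y_int f k x) + of_nat k * (Z_int f (k - 1) x / f x))"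
    using YZ_int_cont f_cont f_nonzero log_deriv_cont by (auto intro!: continuous_intros)
  show "(phi f k has_vector_derivative log_deriv x * (f x * Y_int f k x) + of_nat k * (Z_int f (k - 1) x / f x)) (at x within {-b..b})"
    if "x \<in> {-b..b}" for x
    using phi_quotient_deriv[OF that] unfolding phi_eq[abs_def] .
qed (use b_pos in auto)

lemma c_fun_C1: "c_fun f m \<in> C_space 1 {-b..b}"
proof (cases "m = 0")
  case True
  have "c_fun f m = phi f 0"
    using True by (auto simp: c_fun_def phi_eq YZ_int_0)
  then show ?thesis using phi_C1 by simp
next
  case False
  then show ?thesis
    unfolding c_fun_def[abs_def] if_not_P[OF False]
    using b_pos by (intro C_space_1_sum C_space_1_mult C_space_1_const C_space_1_power_of_real phi_C1) auto
qed

lemma s_fun_C1: "s_fun f m \<in> C_space 1 {-b..b}"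
  unfolding s_fun_def[abs_def]
  using b_pos by (intro C_space_1_sum C_space_1_mult C_space_1_const C_space_1_power_of_real phi_C1) auto

text \<open>All recursive integrals of positive order vanish at 0, so only the coefficient of order
  0 contributes, that is, the summand k = m. Its value is 2 because f(0) = 1; the same normalisation
  gives 0 in \<open>B_wave_0\<close>.\<close>

lemma A_wave_0: "binomial_wave (A_coeff f) m 0 t = 2 * of_real t ^ m"
proof -
  have "A_coeff f k 0 = (if k = 0 then 2 else 0)" for k
    by (cases k) (simp_all add: A_coeff_def YZ_int_0 f_0 Y_int_Suc Z_int_Suc zero_ereal_def)
  then show ?thesis
    unfolding binomial_wave_def
    by (subst sum.mono_neutral_right[of _ "{m}"]) auto
qed

lemma B_wave_0: "binomial_wave (B_coeff f) m 0 t = 0"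
proof -
  have "B_coeff f k 0 = 0" for k
    by (cases k) (simp_all add: B_coeff_def YZ_int_0 f_0 Y_int_Suc Z_int_Suc zero_ereal_def)
  then show ?thesis
    unfolding binomial_wave_def by simp
qed

lemma wave_cont:
  assumes "\<And>k. continuous_on {-b..b} (a k)" "\<beta> \<le> b"
  shows "continuous_on (backward_region \<beta>) (\<lambda>z. binomial_wave a m (fst z) (snd z))"
proof -
  have "continuous_on (backward_region \<beta>) (\<lambda>z. a k (fst z))" for k
    by (rule continuous_on_compose2[OF assms(1)])
      (use assms(2) in \<open>auto intro!: continuous_intros simp: backward_region_def abs_le_iff\<close>)
  then show ?thesis
    unfolding binomial_wave_def by (intro continuous_intros)
qed

lemma deriv_along_characteristic:
  fixes a :: "real \<Rightarrow> complex"
  assumes a: "\<And>x. x \<in> {-b..b} \<Longrightarrow> (a has_vector_derivative a' x) (at x within {-b..b})"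
    and "\<bar>x\<bar> \<le> b" "\<sigma> \<in> {0..1}"
  shows "((\<lambda>\<sigma>. a (x * \<sigma>)) has_vector_derivative of_real x * a' (x * \<sigma>)) (at \<sigma> within {0..1})"
proof -
  have mem: "x * \<sigma> \<in> {-b..b}" if "\<sigma> \<in> {0..1}" for \<sigma>
  proof -
    have "\<bar>x * \<sigma>\<bar> \<le> b * 1"
      unfolding abs_mult using that assms(2) by (intro mult_mono) auto
    then show ?thesis by (auto simp: abs_le_iff)
  qed
  have "((\<lambda>\<sigma>. x * \<sigma>) has_vector_derivative x) (at \<sigma> within {0..1})"
    by (auto intro!: derivative_eq_intros simp flip: has_real_derivative_iff_has_vector_derivative)
  moreover have "(a has_vector_derivative a' (x * \<sigma>)) (at (x * \<sigma>) within (\<lambda>\<sigma>. x * \<sigma>) ` {0..1})"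
    by (rule has_vector_derivative_within_subset[OF a]) (use mem assms(3) in auto)
  ultimately show ?thesis
    using vector_diff_chain_within by (fastforce simp: o_def scaleR_conv_of_real)
qed

text \<open>Along this path the sum of the two arguments is constant, which is the case s = 1 of
  \<open>binomial_transport\<close>. For \<open>B_wave_characteristic\<close> their difference is
  constant and s = -1.\<close>

lemma A_wave_characteristic:
  assumes "\<bar>x\<bar> \<le> b" "\<sigma> \<in> {0..1}"
  shows "((\<lambda>\<sigma>. binomial_wave (A_coeff f) m (x * \<sigma>) (t + x * (1 - \<sigma>))) has_vector_derivative
    of_real x * (log_deriv (x * \<sigma>) * binomial_wave (B_coeff f) m (x * \<sigma>) (t + x * (1 - \<sigma>)))) (at \<sigma> within {0..1})"
proof -
  have "((\<lambda>\<sigma>. \<Sum>k\<le>m. of_nat (m choose k) * (A_coeff f (m - k) (x * \<sigma>) * of_real (t + x * (1 - \<sigma>)) ^ k)) has_vector_derivative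
    of_real x * (\<Sum>k\<le>m. of_nat (m choose k) * ((log_deriv (x * \<sigma>) * B_coeff f (m - k) (x * \<sigma>)) * of_real (t + x * (1 - \<sigma>)) ^ k))) (at \<sigma> within {0..1})"
  proof (rule binomial_transport[where s = 1 and a = "\<lambda>k \<sigma>. A_coeff f k (x * \<sigma>)" and c = "\<lambda>k. log_deriv (x * \<sigma>) * B_coeff f k (x * \<sigma>)"])
    show "((\<lambda>\<sigma>. A_coeff f k (x * \<sigma>)) has_vector_derivative
         of_real x * (log_deriv (x * \<sigma>) * B_coeff f k (x * \<sigma>) + 1 * (of_nat k * A_coeff f (k - 1) (x * \<sigma>)))) (at \<sigma> within {0..1})" for k
      unfolding mult_1 by (rule deriv_along_characteristic[OF A_coeff_deriv assms])
    show "((\<lambda>\<sigma>. complex_of_real (t + x * (1 - \<sigma>))) has_vector_derivative - (of_real x * 1)) (at \<sigma> within {0..1})"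
      by (rule has_vector_derivative_eq_rhs[OF has_vector_derivative_of_real]) (auto intro!: derivative_eq_intros)
  qed
  then show ?thesis
    unfolding binomial_wave_def by (simp only: sum_distrib_left mult.assoc mult.left_commute[of "log_deriv _"])
qed

lemma B_wave_characteristic:
  assumes "\<bar>x\<bar> \<le> b" "\<sigma> \<in> {0..1}"
  shows "((\<lambda>\<sigma>. binomial_wave (B_coeff f) m (x * \<sigma>) (t - x * (1 - \<sigma>))) has_vector_derivative
    of_real x * (log_deriv (x * \<sigma>) * binomial_wave (A_coeff f) m (x * \<sigma>) (t - x * (1 - \<sigma>)))) (at \<sigma> within {0..1})"
proof -
  have "((\<lambda>\<sigma>. \<Sum>k\<le>m. of_nat (m choose k) * (B_coeff f (m - k) (x * \<sigma>) * of_real (t - x * (1 - \<sigma>)) ^ k)) has_vector_derivative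
    of_real x * (\<Sum>k\<le>m. of_nat (m choose k) * ((log_deriv (x * \<sigma>) * A_coeff f (m - k) (x * \<sigma>)) * of_real (t - x * (1 - \<sigma>)) ^ k))) (at \<sigma> within {0..1})"
  proof (rule binomial_transport[where s = "-1" and a = "\<lambda>k \<sigma>. B_coeff f k (x * \<sigma>)" and c = "\<lambda>k. log_deriv (x * \<sigma>) * A_coeff f k (x * \<sigma>)"])
    show "((\<lambda>\<sigma>. B_coeff f k (x * \<sigma>)) has_vector_derivative
         of_real x * (log_deriv (x * \<sigma>) * A_coeff f k (x * \<sigma>) + -1 * (of_nat k * B_coeff f (k - 1) (x * \<sigma>)))) (at \<sigma> within {0..1})" for k
      unfolding mult_minus1 add_uminus_conv_diff by (rule deriv_along_characteristic[OF B_coeff_deriv assms])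
    show "((\<lambda>\<sigma>. complex_of_real (t - x * (1 - \<sigma>))) has_vector_derivative - (of_real x * -1)) (at \<sigma> within {0..1})"
      by (rule has_vector_derivative_eq_rhs[OF has_vector_derivative_of_real]) (auto intro!: derivative_eq_intros)
  qed
  then show ?thesis
    unfolding binomial_wave_def by (simp only: sum_distrib_left mult.assoc mult.left_commute[of "log_deriv _"])
qed

section \<open>Comparison of the traces with polynomials\<close>

text \<open>The characteristic estimate is used with \<beta> = \<bar>x\<bar> instead of b, so that
  the exponential on the right is the weight at x itself. The remaining dependence on \<bar>x\<bar>
  is absorbed into \<open>K\<close>, which is uniform in the polynomial, in \<mu> and in the
  point.\<close>

lemma wave_estimate:
  obtains K where "0 < K" "\<And>J (a :: nat \<Rightarrow> complex) \<mu> N x t.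
    \<lbrakk>0 < \<mu>; 0 \<le> N; \<bar>x\<bar> \<le> b; \<bar>t\<bar> \<le> \<bar>x\<bar>;
      \<And>y. \<bar>y\<bar> \<le> 2 * \<bar>x\<bar> \<Longrightarrow> norm (\<Sum>j\<in>J. a j * of_real y ^ j) \<le> N * exp (\<mu> * \<bar>y\<bar>)\<rbrakk> \<Longrightarrow>
    norm ((\<Sum>j\<in>J. a j * (binomial_wave (A_coeff f) j x t + binomial_wave (B_coeff f) j x t)) / 2
      - (\<Sum>j\<in>J. a j * of_real (x + t) ^ j)) \<le> K * N * exp (2 * \<mu> * \<bar>x\<bar>) / \<mu>"
proof -
  have "bounded (log_deriv ` {-b..b})"
    by (intro compact_imp_bounded compact_continuous_image log_deriv_cont compact_Icc)
  then obtain C where C: "0 < C" "\<And>y. \<bar>y\<bar> \<le> b \<Longrightarrow> norm (log_deriv y) \<le> C"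
    by (auto simp: bounded_pos abs_le_iff)
  define K where "K = 4 * C * exp (2 * C * b)"
  have "norm ((\<Sum>j\<in>J. a j * (binomial_wave (A_coeff f) j x t + binomial_wave (B_coeff f) j x t)) / 2
      - (\<Sum>j\<in>J. a j * of_real (x + t) ^ j)) \<le> K * N * exp (2 * \<mu> * \<bar>x\<bar>) / \<mu>"
    if \<mu>: "0 < \<mu>" and N: "0 \<le> N" and x: "\<bar>x\<bar> \<le> b" and t: "\<bar>t\<bar> \<le> \<bar>x\<bar>"
      and bound: "\<And>y. \<bar>y\<bar> \<le> 2 * \<bar>x\<bar> \<Longrightarrow> norm (\<Sum>j\<in>J. a j * of_real y ^ j) \<le> N * exp (\<mu> * \<bar>y\<bar>)"
    for J \<mu> N x t and a :: "nat \<Rightarrow> complex"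
  proof -
    define p where "p y = (\<Sum>j\<in>J. a j * of_real y ^ j)" for y
    \<comment> \<open>2 p(y + s) solves the uncoupled equation with the same values on the axis.
      Subtracting it makes \<open>Q\<close> vanish there and moves \<open>p\<close> into the source
      of the equation for \<open>S\<close>.\<close>
    define Q where "Q y s = (\<Sum>j\<in>J. a j * binomial_wave (A_coeff f) j y s) - 2 * p (y + s)" for y s
    define S where "S y s = (\<Sum>j\<in>J. a j * binomial_wave (B_coeff f) j y s)" for y s
    have in_interval: "\<bar>y\<bar> \<le> b" if "(y, s) \<in> backward_region \<bar>x\<bar>" for y s
      using that x by (simp add: backward_region_def)
    have A_cont: "continuous_on {-b..b} (A_coeff f k)" for k
      using A_coeff_deriv by (rule continuous_on_vector_derivative)
    have B_cont: "continuous_on {-b..b} (B_coeff f k)" for k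
      using B_coeff_deriv by (rule continuous_on_vector_derivative)
    have Q_cont: "continuous_on (backward_region \<bar>x\<bar>) (\<lambda>z. Q (fst z) (snd z))"
      unfolding Q_def p_def by (intro continuous_intros wave_cont A_cont x)
    have S_cont: "continuous_on (backward_region \<bar>x\<bar>) (\<lambda>z. S (fst z) (snd z))"
      unfolding S_def by (intro continuous_intros wave_cont B_cont x)
    have Q_0: "Q 0 s = 0" and S_0: "S 0 s = 0" for s
      by (simp_all add: Q_def S_def p_def A_wave_0 B_wave_0 sum_distrib_left mult_ac)
    have Q': "((\<lambda>\<sigma>. Q (y * \<sigma>) (s + y * (1 - \<sigma>))) has_vector_derivative
        of_real y * (log_deriv (y * \<sigma>) * S (y * \<sigma>) (s + y * (1 - \<sigma>)))) (at \<sigma> within {0..1})"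
      if "(y, s) \<in> backward_region \<bar>x\<bar>" "\<sigma> \<in> {0..1}" for y s \<sigma>
    proof -
      have sum_eq: "y * \<sigma> + (s + y * (1 - \<sigma>)) = y + s" for \<sigma> by (simp add: algebra_simps)
      have "((\<lambda>\<sigma>. Q (y * \<sigma>) (s + y * (1 - \<sigma>))) has_vector_derivative
        (\<Sum>j\<in>J. a j * (of_real y * (log_deriv (y * \<sigma>) * binomial_wave (B_coeff f) j (y * \<sigma>) (s + y * (1 - \<sigma>))))) - 0)
        (at \<sigma> within {0..1})"
        unfolding Q_def sum_eq
        by (intro has_vector_derivative_diff has_vector_derivative_sum has_vector_derivative_mult_right
            A_wave_characteristic has_vector_derivative_const in_interval[OF that(1)] that(2))
      then show ?thesis
        by (rule has_vector_derivative_eq_rhs) (simp add: S_def sum_distrib_left mult_ac)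
    qed
    have S': "((\<lambda>\<sigma>. S (y * \<sigma>) (s - y * (1 - \<sigma>))) has_vector_derivative
        of_real y * (log_deriv (y * \<sigma>) * (2 * p (y * \<sigma> + (s - y * (1 - \<sigma>))) + Q (y * \<sigma>) (s - y * (1 - \<sigma>)))))
        (at \<sigma> within {0..1})"
      if "(y, s) \<in> backward_region \<bar>x\<bar>" "\<sigma> \<in> {0..1}" for y s \<sigma>
    proof -
      have "((\<lambda>\<sigma>. S (y * \<sigma>) (s - y * (1 - \<sigma>))) has_vector_derivative
        (\<Sum>j\<in>J. a j * (of_real y * (log_deriv (y * \<sigma>) * binomial_wave (A_coeff f) j (y * \<sigma>) (s - y * (1 - \<sigma>))))))
        (at \<sigma> within {0..1})"
        unfolding S_def
        by (intro has_vector_derivative_sum has_vector_derivative_mult_right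
            B_wave_characteristic in_interval[OF that(1)] that(2))
      then show ?thesis
        by (rule has_vector_derivative_eq_rhs) (simp add: Q_def sum_distrib_left mult_ac)
    qed
    have xt: "(x, t) \<in> backward_region \<bar>x\<bar>"
      using t by (simp add: backward_region_def)
    have log_deriv_le: "norm (log_deriv y) \<le> C" if "\<bar>y\<bar> \<le> \<bar>x\<bar>" for y
      using C(2) x that by simp
    let ?M = "4 * C * exp (2 * C * \<bar>x\<bar>) * N * exp (2 * \<mu> * \<bar>x\<bar>) / \<mu>"
    note est = characteristic_estimate[where Q = Q and S = S and r = log_deriv and p = p,
        OF C(1) \<mu> N abs_ge_zero log_deriv_le bound[folded p_def] Q_cont S_cont Q_0 S_0 Q' S' xt]
    have "(\<Sum>j\<in>J. a j * (binomial_wave (A_coeff f) j x t + binomial_wave (B_coeff f) j x t)) / 2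
      - (\<Sum>j\<in>J. a j * of_real (x + t) ^ j) = (Q x t + S x t) / 2"
      unfolding Q_def S_def p_def by (simp add: distrib_left sum.distrib add_divide_distrib diff_divide_distrib)
    also have "norm \<dots> \<le> (?M + ?M) / 2"
      using norm_triangle_mono[OF est] by (simp add: norm_divide)
    also have "\<dots> = (4 * C * exp (2 * C * \<bar>x\<bar>)) * (N * exp (2 * \<mu> * \<bar>x\<bar>) / \<mu>)"
      by simp
    also have "\<dots> \<le> K * (N * exp (2 * \<mu> * \<bar>x\<bar>) / \<mu>)"
      unfolding K_def using C(1) x \<mu> N by (intro mult_right_mono) auto
    finally show ?thesis by (simp add: mult.assoc)
  qed
  moreover have "0 < K" unfolding K_def using C(1) by simp
  ultimately show ?thesis using that by blast
qed

text \<open>With \<open>p(y) = y\<^sup>j\<close>, this is the coefficient of \<open>x\<^sup>j\<close> in \<open>(p(2x) + p(0))/2\<close>; for \<open>j > 0\<close> the sign of \<open>p(0)\<close>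
  is immaterial, so the same scale serves both systems.\<close>

definition trace_scale :: "nat \<Rightarrow> complex" where
  "trace_scale j = (2 ^ j + 0 ^ j) / 2"

lemma trace_scale_nonzero: "trace_scale j \<noteq> 0"
  by (cases j) (auto simp: trace_scale_def)

text \<open>On the traces t = x and t = -x the leading term p(x + t) becomes p(2x) and p(0). Since
  \<open>wave_estimate\<close> asks for a bound on p itself, the bound on the comparison combination
  is first converted into one on p(2x).\<close>

lemma perturbation_from_traces:
  obtains \<mu> where "0 < \<mu>"
    "weighted_perturbation {-b..b} {0..} (\<lambda>x. exp (2 * \<mu> * \<bar>x\<bar>)) (\<lambda>j x. trace_scale j * of_real x ^ j) (c_fun f)"
    "weighted_perturbation {-b..b} {1..} (\<lambda>x. exp (2 * \<mu> * \<bar>x\<bar>)) (\<lambda>j x. trace_scale j * of_real x ^ j) (s_fun f)"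
proof -
  define U where "U j x t = (binomial_wave (A_coeff f) j x t + binomial_wave (B_coeff f) j x t) / 2" for j x t
  obtain K where K: "0 < K" and wave: "\<And>J (a :: nat \<Rightarrow> complex) \<mu> N x t.
    \<lbrakk>0 < \<mu>; 0 \<le> N; \<bar>x\<bar> \<le> b; \<bar>t\<bar> \<le> \<bar>x\<bar>;
      \<And>y. \<bar>y\<bar> \<le> 2 * \<bar>x\<bar> \<Longrightarrow> norm (\<Sum>j\<in>J. a j * of_real y ^ j) \<le> N * exp (\<mu> * \<bar>y\<bar>)\<rbrakk> \<Longrightarrow>
    norm ((\<Sum>j\<in>J. a j * (binomial_wave (A_coeff f) j x t + binomial_wave (B_coeff f) j x t)) / 2
      - (\<Sum>j\<in>J. a j * of_real (x + t) ^ j)) \<le> K * N * exp (2 * \<mu> * \<bar>x\<bar>) / \<mu>"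
    by (rule wave_estimate) blast
  have est: "norm ((\<Sum>j\<in>J. a j * U j x t) - (\<Sum>j\<in>J. a j * of_real (x + t) ^ j)) \<le> K * N * exp (2 * \<mu> * \<bar>x\<bar>) / \<mu>"
    if "0 < \<mu>" "0 \<le> N" "\<bar>x\<bar> \<le> b" "\<bar>t\<bar> \<le> \<bar>x\<bar>"
      "\<And>y. \<bar>y\<bar> \<le> 2 * \<bar>x\<bar> \<Longrightarrow> norm (\<Sum>j\<in>J. a j * of_real y ^ j) \<le> N * exp (\<mu> * \<bar>y\<bar>)"
    for J \<mu> N x t and a :: "nat \<Rightarrow> complex"
    unfolding U_def times_divide_eq_right sum_divide_distrib[symmetric] by (rule wave[OF that])
  \<comment> \<open>Makes K (3N)/\<mu> equal to N/2; the 3N is the weighted bound on p(2x) recovered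
    from the bound N on the comparison combination.\<close>
  define \<mu> where "\<mu> = 6 * K"
  have "0 < \<mu>" unfolding \<mu>_def using K by simp
  have c_eq: "c_fun f j x = (U j x x + U j x (-x)) / 2" for j x
    by (simp add: c_fun_eq U_def field_simps)
  have s_eq: "s_fun f j x = (U j x x - U j x (-x)) / 2" for j x
    by (simp add: s_fun_eq U_def field_simps)
  have U_est: "norm ((\<Sum>j\<in>J. a j * U j x t) - (\<Sum>j\<in>J. a j * of_real (x + t) ^ j)) \<le> N / 2 * exp (2 * \<mu> * \<bar>x\<bar>)"
    if N: "0 \<le> N" and x: "x \<in> {-b..b}" and "\<bar>t\<bar> \<le> \<bar>x\<bar>"
      and p: "\<And>x. x \<in> {-b..b} \<Longrightarrow> norm (\<Sum>j\<in>J. a j * of_real (2 * x) ^ j) \<le> 3 * N * exp (2 * \<mu> * \<bar>x\<bar>)"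
    for J N x t and a :: "nat \<Rightarrow> complex"
  proof -
    \<comment> \<open>The substitution of y/2 for x keeps the argument in the interval and turns the
      weight exp (2\<mu>\<bar>x\<bar>) into exp (\<mu>\<bar>y\<bar>).\<close>
    have "norm (\<Sum>j\<in>J. a j * of_real y ^ j) \<le> (3 * N) * exp (\<mu> * \<bar>y\<bar>)" if "\<bar>y\<bar> \<le> 2 * \<bar>x\<bar>" for y
    proof -
      have "\<bar>y\<bar> \<le> 2 * b" using that x by auto
      then have "y / 2 \<in> {-b..b}" by (auto simp: abs_le_iff)
      from p[OF this] show ?thesis by simp
    qed
    then have "norm ((\<Sum>j\<in>J. a j * U j x t) - (\<Sum>j\<in>J. a j * of_real (x + t) ^ j))
        \<le> K * (3 * N) * exp (2 * \<mu> * \<bar>x\<bar>) / \<mu>"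
      using \<open>0 < \<mu>\<close> N x \<open>\<bar>t\<bar> \<le> \<bar>x\<bar>\<close> by (intro est) auto
    also have "\<dots> = N / 2 * exp (2 * \<mu> * \<bar>x\<bar>)"
      using K unfolding \<mu>_def by (simp add: field_simps)
    finally show ?thesis .
  qed
  have scale: "trace_scale j * of_real x ^ j = (of_real (x + x) ^ j + of_real (x + - x) ^ j) / 2" for j x
    unfolding trace_scale_def by (cases j) (simp_all add: power_mult_distrib flip: mult_2)
  have one_le: "1 \<le> exp (2 * \<mu> * \<bar>x\<bar>)" for x
    using \<open>0 < \<mu>\<close> by simp
  have "weighted_perturbation {-b..b} {0..} (\<lambda>x. exp (2 * \<mu> * \<bar>x\<bar>)) (\<lambda>j x. trace_scale j * of_real x ^ j) (c_fun f)"
  proof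
    fix J N a x
    assume N: "0 \<le> N" and x: "x \<in> {-b..b}"
      and D: "\<And>x. x \<in> {-b..b} \<Longrightarrow> norm (\<Sum>j\<in>J. a j * (trace_scale j * of_real x ^ j)) \<le> N * exp (2 * \<mu> * \<bar>x\<bar>)"
    define p where "p y = (\<Sum>j\<in>J. a j * complex_of_real y ^ j)" for y
    have D_eq: "(\<Sum>j\<in>J. a j * (trace_scale j * of_real x ^ j)) = (p (x + x) + p (x + - x)) / 2" for x
      unfolding p_def scale by (simp only: sum.distrib[symmetric] distrib_left[symmetric] sum_divide_distrib times_divide_eq_right)
    \<comment> \<open>At the origin the comparison combination is p(0) and the weight is 1. Solving
      for p(2x) then costs twice the bound \<open>N\<close> plus this one.\<close>
    have "norm (p 0) \<le> N"
      using D[of 0] b_pos unfolding D_eq by simp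
    have p: "norm (p (2 * x)) \<le> 3 * N * exp (2 * \<mu> * \<bar>x\<bar>)" if "x \<in> {-b..b}" for x
    proof -
      define d where "d = (p (x + x) + p (x + - x)) / 2"
      have "norm d \<le> N * exp (2 * \<mu> * \<bar>x\<bar>)"
        using D[OF that] unfolding D_eq d_def .
      moreover have "p (2 * x) = 2 * d - p 0"
        by (simp add: d_def add_divide_distrib)
      then have "norm (p (2 * x)) \<le> 2 * norm d + norm (p 0)"
        using norm_triangle_ineq4[of "2 * d" "p 0"] by (simp add: norm_mult)
      moreover have "N * 1 \<le> N * exp (2 * \<mu> * \<bar>x\<bar>)"
        using N one_le by (intro mult_left_mono)
      ultimately show ?thesis using \<open>norm (p 0) \<le> N\<close> by linarith
    qed
    have U_x: "norm ((\<Sum>j\<in>J. a j * U j x x) - p (x + x)) \<le> N / 2 * exp (2 * \<mu> * \<bar>x\<bar>)"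
      unfolding p_def by (rule U_est[OF N x _ p[unfolded p_def]]) simp
    have U_minus_x: "norm ((\<Sum>j\<in>J. a j * U j x (-x)) - p (x + - x)) \<le> N / 2 * exp (2 * \<mu> * \<bar>x\<bar>)"
      unfolding p_def by (rule U_est[OF N x _ p[unfolded p_def]]) simp
    have "(\<Sum>j\<in>J. a j * c_fun f j x) - (\<Sum>j\<in>J. a j * (trace_scale j * of_real x ^ j))
      = (((\<Sum>j\<in>J. a j * U j x x) - p (x + x)) + ((\<Sum>j\<in>J. a j * U j x (-x)) - p (x + - x))) / 2"
      unfolding D_eq c_eq by (simp add: distrib_left sum.distrib diff_divide_distrib add_divide_distrib flip: sum_divide_distrib)
    also have "norm \<dots> \<le> (N / 2 * exp (2 * \<mu> * \<bar>x\<bar>) + N / 2 * exp (2 * \<mu> * \<bar>x\<bar>)) / 2"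
      unfolding norm_divide using norm_triangle_mono[OF U_x U_minus_x] by simp
    finally show "norm ((\<Sum>j\<in>J. a j * c_fun f j x) - (\<Sum>j\<in>J. a j * (trace_scale j * of_real x ^ j)))
      \<le> N / 2 * exp (2 * \<mu> * \<bar>x\<bar>)" by simp
  qed (use one_le in auto)
  moreover have "weighted_perturbation {-b..b} {1..} (\<lambda>x. exp (2 * \<mu> * \<bar>x\<bar>)) (\<lambda>j x. trace_scale j * of_real x ^ j) (s_fun f)"
  proof
    fix J N a x
    assume J: "J \<subseteq> {1..}" and N: "0 \<le> N" and x: "x \<in> {-b..b}"
      and D: "\<And>x. x \<in> {-b..b} \<Longrightarrow> norm (\<Sum>j\<in>J. a j * (trace_scale j * of_real x ^ j)) \<le> N * exp (2 * \<mu> * \<bar>x\<bar>)"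
    define p where "p y = (\<Sum>j\<in>J. a j * complex_of_real y ^ j)" for y
    \<comment> \<open>The index 0 is absent here. Hence the half sum of p(2x) and p(0) given by
      \<open>trace_scale\<close> is also their half difference, which is what the odd part
      produces.\<close>
    have p_0: "p 0 = 0"
      unfolding p_def using J by (intro sum.neutral) (auto simp: power_0_left)
    have D_eq: "(\<Sum>j\<in>J. a j * (trace_scale j * of_real x ^ j)) = (p (x + x) + p (x + - x)) / 2" for x
      unfolding p_def scale by (simp only: sum.distrib[symmetric] distrib_left[symmetric] sum_divide_distrib times_divide_eq_right)
    have p: "norm (p (2 * x)) \<le> 3 * N * exp (2 * \<mu> * \<bar>x\<bar>)" if "x \<in> {-b..b}" for x
    proof -
      have "norm (p (2 * x)) \<le> 2 * (N * exp (2 * \<mu> * \<bar>x\<bar>))"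
        using D[OF that] unfolding D_eq by (simp add: p_0 norm_divide flip: mult_2)
      then show ?thesis using mult_nonneg_nonneg[OF N exp_ge_zero[of "2 * \<mu> * \<bar>x\<bar>"]] by linarith
    qed
    have U_x: "norm ((\<Sum>j\<in>J. a j * U j x x) - p (x + x)) \<le> N / 2 * exp (2 * \<mu> * \<bar>x\<bar>)"
      unfolding p_def by (rule U_est[OF N x _ p[unfolded p_def]]) simp
    have U_minus_x: "norm ((\<Sum>j\<in>J. a j * U j x (-x)) - p (x + - x)) \<le> N / 2 * exp (2 * \<mu> * \<bar>x\<bar>)"
      unfolding p_def by (rule U_est[OF N x _ p[unfolded p_def]]) simp
    have "(\<Sum>j\<in>J. a j * s_fun f j x) - (\<Sum>j\<in>J. a j * (trace_scale j * of_real x ^ j))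
      = (((\<Sum>j\<in>J. a j * U j x x) - p (x + x)) - ((\<Sum>j\<in>J. a j * U j x (-x)) - p (x + - x))) / 2"
      unfolding D_eq s_eq by (simp add: p_0 right_diff_distrib sum_subtractf diff_divide_distrib flip: sum_divide_distrib)
    also have "norm \<dots> \<le> (N / 2 * exp (2 * \<mu> * \<bar>x\<bar>) + N / 2 * exp (2 * \<mu> * \<bar>x\<bar>)) / 2"
      unfolding norm_divide using order_trans[OF norm_triangle_ineq4 add_mono[OF U_x U_minus_x]] by simp
    finally show "norm ((\<Sum>j\<in>J. a j * s_fun f j x) - (\<Sum>j\<in>J. a j * (trace_scale j * of_real x ^ j)))
      \<le> N / 2 * exp (2 * \<mu> * \<bar>x\<bar>)" by simp
  qed (use one_le in auto)
  ultimately show ?thesis using that \<open>0 < \<mu>\<close> by blast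
qed

section \<open>Completeness and independence of the two systems\<close>

lemma complete_systemI:
  assumes pert: "weighted_perturbation {-b..b} I (\<lambda>x. exp (2 * \<mu> * \<bar>x\<bar>)) D g" and \<mu>: "0 < \<mu>"
    and U: "U \<subseteq> C_space 1 {-b..b}" and g: "\<And>i. i \<in> I \<Longrightarrow> g i \<in> U"
    and closed: "\<And>u v. \<lbrakk>u \<in> U; v \<in> lin_span I g\<rbrakk> \<Longrightarrow> (\<lambda>x. u x - v x) \<in> U"
    and dense: "\<And>u e. \<lbrakk>u \<in> U; 0 < e\<rbrakk> \<Longrightarrow> \<exists>v\<in>lin_span I D. \<forall>x\<in>{-b..b}. norm (u x - v x) \<le> e"
  shows "complete_system {-b..b} U I g"
  unfolding complete_system_def
proof (intro conjI ballI allI impI)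
  fix u and \<epsilon> :: real assume u: "u \<in> U" "0 < \<epsilon>"
  interpret weighted_perturbation "{-b..b}" I "\<lambda>x. exp (2 * \<mu> * \<bar>x\<bar>)" D g by (rule pert)
  \<comment> \<open>Half of \<epsilon> is taken because a pointwise bound passes to the supremum
    only as a non-strict inequality.\<close>
  have "\<exists>v\<in>lin_span I g. \<forall>x\<in>{-b..b}. norm (u x - v x) \<le> \<epsilon> / 2"
  proof (rule dense_perturbed[where U = U and W = "exp (2 * \<mu> * b)"])
    show "continuous_on {-b..b} w" if "w \<in> U" for w
      using U that by (blast intro: C_space_1_continuous)
    show "exp (2 * \<mu> * \<bar>x\<bar>) \<le> exp (2 * \<mu> * b)" if "x \<in> {-b..b}" for x
      using that \<mu> by (auto simp: abs_le_iff)
  qed (use u in \<open>simp_all add: closed dense\<close>)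
  then obtain v where v: "v \<in> lin_span I g" "\<And>x. x \<in> {-b..b} \<Longrightarrow> norm (u x - v x) \<le> \<epsilon> / 2"
    by blast
  have "max_norm {-b..b} (\<lambda>x. u x - v x) \<le> \<epsilon> / 2"
    unfolding max_norm_def using v(2) b_pos by (intro cSUP_least) auto
  then show "\<exists>v\<in>lin_span I g. max_norm {-b..b} (\<lambda>x. u x - v x) < \<epsilon>"
    using v(1) u(2) by (intro bexI[of _ v]) auto
qed (rule g)

lemma s_fun_0: "s_fun f m 0 = 0"
  unfolding s_fun_def by (intro sum.neutral) (auto elim: oddE)

lemma span_C1:
  assumes "\<And>i. i \<in> I \<Longrightarrow> g i \<in> C_space 1 {-b..b}" "v \<in> lin_span I g"
  shows "v \<in> C_space 1 {-b..b}"
proof -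
  obtain J a where J: "finite J" "J \<subseteq> I" and v: "v = (\<lambda>x. \<Sum>j\<in>J. a j * g j x)"
    using assms(2) by (rule lin_spanE)
  show ?thesis
    unfolding v using b_pos J assms(1) by (intro C_space_1_sum C_space_1_mult C_space_1_const) auto
qed

lemma complete_and_independent:
  "lin_indep_on {-b..b} {0..} (c_fun f)
    \<and> lin_indep_on {-b..b} {1..} (s_fun f)
    \<and> complete_system {-b..b} (C_space 1 {-b..b}) {0..} (c_fun f)
    \<and> complete_system {-b..b} (C1_0_space {-b..b}) {1..} (s_fun f)"
proof -
  let ?D = "\<lambda>j x. trace_scale j * complex_of_real x ^ j"
  obtain \<mu> where \<mu>: "0 < \<mu>"
    and c: "weighted_perturbation {-b..b} {0..} (\<lambda>x. exp (2 * \<mu> * \<bar>x\<bar>)) ?D (c_fun f)"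
    and s: "weighted_perturbation {-b..b} {1..} (\<lambda>x. exp (2 * \<mu> * \<bar>x\<bar>)) ?D (s_fun f)"
    by (rule perturbation_from_traces)
  have D_cont: "continuous_on {-b..b} (?D j)" for j
    by (intro continuous_intros)
  have D_indep: "lin_indep_on {-b..b} I ?D" for I
    using b_pos trace_scale_nonzero by (rule monomials_lin_indep)
  have "lin_indep_on {-b..b} {0..} (c_fun f)"
    using weighted_perturbation.lin_indep_perturbed[OF c D_cont D_indep] .
  moreover have "lin_indep_on {-b..b} {1..} (s_fun f)"
    using weighted_perturbation.lin_indep_perturbed[OF s D_cont D_indep] .
  moreover have "complete_system {-b..b} (C_space 1 {-b..b}) {0..} (c_fun f)"
  proof (rule complete_systemI[OF c \<mu> order_refl c_fun_C1])
    show "(\<lambda>x. u x - v x) \<in> C_space 1 {-b..b}" if "u \<in> C_space 1 {-b..b}" "v \<in> lin_span {0..} (c_fun f)" for u v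
      using b_pos by (intro C_space_1_diff that(1) span_C1[OF c_fun_C1 that(2)]) simp
    show "\<exists>v\<in>lin_span {0..} ?D. \<forall>x\<in>{-b..b}. norm (u x - v x) \<le> e" if "u \<in> C_space 1 {-b..b}" "0 < e" for u e
      by (rule monomials_dense[OF trace_scale_nonzero C_space_1_continuous[OF that(1)] that(2)])
  qed
  moreover have "complete_system {-b..b} (C1_0_space {-b..b}) {1..} (s_fun f)"
  proof (rule complete_systemI[OF s \<mu>])
    show "C1_0_space {-b..b} \<subseteq> C_space 1 {-b..b}"
      unfolding C1_0_space_def by blast
    show "s_fun f i \<in> C1_0_space {-b..b}" for i
      unfolding C1_0_space_def using s_fun_C1 s_fun_0 by blast
    show "(\<lambda>x. u x - v x) \<in> C1_0_space {-b..b}" if "u \<in> C1_0_space {-b..b}" "v \<in> lin_span {1..} (s_fun f)" for u v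
    proof -
      have "v 0 = 0"
        using that(2) by (rule lin_spanE) (simp add: s_fun_0)
      moreover have "(\<lambda>x. u x - v x) \<in> C_space 1 {-b..b}"
        using that(1) b_pos unfolding C1_0_space_def by (intro C_space_1_diff span_C1[OF s_fun_C1 that(2)]) simp_all
      ultimately show ?thesis
        using that(1) unfolding C1_0_space_def by simp
    qed
    show "\<exists>v\<in>lin_span {1..} ?D. \<forall>x\<in>{-b..b}. norm (u x - v x) \<le> e" if "u \<in> C1_0_space {-b..b}" "0 < e" for u e
      using that unfolding C1_0_space_def
      by (intro monomials_dense_vanishing[OF b_pos trace_scale_nonzero] C_space_1_continuous) blast+
  qed
  ultimately show ?thesis by blast
qed

end

theorem corollary4p5:
  fixes b :: real and q f :: "real \<Rightarrow> complex"
  assumes "b > 0"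
    and "continuous_on {-b..b} q"
    and "f \<in> C_space 2 {-b..b}"
    and "\<forall>x\<in>{-b..b}. deriv_within {-b..b} (deriv_within {-b..b} f) x - q x * f x = 0"
    and "\<forall>x\<in>{-b..b}. f x \<noteq> 0"
    and "f 0 = 1"
  shows "lin_indep_on {-b..b} {0..} (c_fun f)
    \<and> lin_indep_on {-b..b} {1..} (s_fun f)
    \<and> complete_system {-b..b} (C_space 1 {-b..b}) {0..} (c_fun f)
    \<and> complete_system {-b..b} (C1_0_space {-b..b}) {1..} (s_fun f)"
proof -
  have "f \<in> C_space 1 {-b..b}"
    using assms(3) by (simp add: numeral_2_eq_2 differentiable_imp_continuous_on)
  moreover have "-b < b" using assms(1) by simp
  ultimately obtain f' where f': "continuous_on {-b..b} f'"
    "\<And>x. x \<in> {-b..b} \<Longrightarrow> (f has_vector_derivative f' x) (at x within {-b..b})"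
    by (rule C_space_1E) blast
  interpret nonvanishing_C1 b f f'
    using assms f' by unfold_locales auto
  show ?thesis by (rule complete_and_independent)
qed

end
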